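(* Let $A=[\mathbf{a}_1,\dots,\mathbf{a}_n]\in\mathbb{Z}^{m\times n}$ have no free bouquet, let $B_1,\dots,B_s$ be its bouquets, let $A_B=[\mathbf{a}_{B_1},\dots,\mathbf{a}_{B_s}]$, and suppose that $I_A$ is a stable toric ideal. Then $I_A$ is a generic toric ideal if and only if $I_{A_B}$ is a generic toric ideal.
   Context: For $A=[\mathbf{a}_1,\dots,\mathbf{a}_n]\in\mathbb{Z}^{m\times n}$ let $\operatorname{Ker}_{\mathbb{Z}}(A)=\{\mathbf{u}\in\mathbb{Z}^n:A\mathbf{u}=\mathbf{0}\}$. For an integer vector write $\mathbf{u}=\mathbf{u}^+-\mathbf{u}^-$ with $\mathbf{u}^{\pm}$ nonnegative of disjoint support. Over a field $K$, $I_A=(\mathbf{x}^{\mathbf{u}^+}-\mathbf{x}^{\mathbf{u}^-}:\mathbf{u}\in\operatorname{Ker}_{\mathbb{Z}}(A))\subset K[x_1,\dots,x_n]$ is the toric ideal of $A$. It is generic if it is minimally generated by binomials with full support, i.e. it has a minimal generating set $\{\mathbf{x}^{\mathbf{u}_1}-\mathbf{x}^{\mathbf{v}_1},\dots,\mathbf{x}^{\mathbf{u}_k}-\mathbf{x}^{\mathbf{v}_k}\}$ such that none of the vectors $\mathbf{u}_i-\mathbf{v}_i$ has a zero coordinate. Gale transform: let $r=\operatorname{rank}A$, fix a basis $G_1,\dots,G_{n-r}$ of the lattice $\operatorname{Ker}_{\mathbb{Z}}(A)$, and let $G(\mathbf{a}_i)\in\mathbb{Z}^{n-r}$ be the $i$-th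 row of the matrix with columns $G_1,\dots,G_{n-r}$. Bouquets: a co-vector of $A$ is a vector $(\mathbf{v}\cdot\mathbf{a}_1,\dots,\mathbf{v}\cdot\mathbf{a}_n)$ with $\mathbf{v}\in\mathbb{Z}^m$; a co-circuit is a nonzero co-vector of minimal support. $\mathbf{a}_i$ is free if $\{i\}$ is the support of a co-circuit (equivalently $G(\mathbf{a}_i)=\mathbf{0}$); $A$ has no free bouquet if no $\mathbf{a}_i$ is free. The bouquet graph $G_A$ has vertices $\mathbf{a}_1,\dots,\mathbf{a}_n$ (distinguished by their indices), and $\{\mathbf{a}_i,\mathbf{a}_j\}$, $i\neq j$, is an edge if there is a co-vector with support $\{i,j\}$. When there are no free vectors such a co-vector is a co-circuit; the edge is in $E_A^+$ if its two nonzero coordinates have distinct signs and in $E_A^-$ if they have the same sign. The bouquets of $A$ are the connected components of $G_A$. A (non-free) bouquet is mixed if it contains an edge of $E_A^-$, and non-mixed if it is an isolated vertex or all its edges are in $E_A^+$. $I_A$ is stable if all bouquets of $A$ are non-mixed. Vectors $\mathbf{c}_B$, $\mathbf{a}_B$ of a bouquet $B$: choose a coordinate $j$ with $G(\mathbf{a}_i)_j\neq0$ for all $\mathbf{a}_i\in B$ (these Gale vectors are nonzero and pairwise proportional), let $g_j=\gcd(G(\mathbf{a}_i)_j:\mathbf{a}_i\in B)$, let $i_0$ be the smallest index with $\mathbf{a}_{i_0}\in B$, let $\varepsilon$ be the sign of $G(\mathbf{a}_{i_0})_j$, and let $\mathbf{c}_B\in\mathbb{Z}^n$ have $i$-th coordinate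 $\varepsilon G(\mathbf{a}_i)_j/g_j$ if $\mathbf{a}_i\in B$ and $0$ otherwise (independent of $j$). Set $\mathbf{a}_B=\sum_{i=1}^n(\mathbf{c}_B)_i\mathbf{a}_i$. *)

theory Defs
  imports
    "HOL-Library.Poly_Mapping"
    "HOL-Algebra.Ideal"
    "Jordan_Normal_Form.Matrix_Kernel"
    "Jordan_Normal_Form.DL_Rank"
begin

text \<open>Rows, columns and variables are indexed from 0: the vectors \<open>a\<^sub>1, \<dots>, a\<^sub>n\<close> are
  \<^term>\<open>col A 0\<close>, \<dots>, \<open>col A (n - 1)\<close>.\<close>

section \<open>Toric ideals\<close>

text \<open>Exponent vectors are finitely supported functions \<^typ>\<open>nat \<Rightarrow>\<^sub>0 nat\<close>, and
  \<open>K[x\<^sub>0, \<dots>, x\<^bsub>n-1\<^esub>]\<close> is the subring of the polynomials in countably many variables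
  in which only variables of index \<open>< n\<close> occur.\<close>

type_synonym 'k mpoly = "(nat \<Rightarrow>\<^sub>0 nat) \<Rightarrow>\<^sub>0 'k"

definition poly_ring :: "nat \<Rightarrow> 'k::field mpoly ring" where
  "poly_ring n =
     \<lparr>carrier = {p. \<forall>t \<in> Poly_Mapping.keys p. Poly_Mapping.keys t \<subseteq> {..<n}},
      mult = (*), one = 1, zero = 0, add = (+)\<rparr>"

definition monomial :: "nat vec \<Rightarrow> 'k::field mpoly" where
  "monomial u = Poly_Mapping.single (\<Sum>i<dim_vec u. Poly_Mapping.single i (u $ i)) 1"

definition pos_part :: "int vec \<Rightarrow> nat vec" where
  "pos_part u = map_vec nat u"

definition neg_part :: "int vec \<Rightarrow> nat vec" where
  "neg_part u = map_vec (\<lambda>z. nat (- z)) u"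

definition toric_ideal :: "int mat \<Rightarrow> 'k::field mpoly set" where
  "toric_ideal A =
     Idl\<^bsub>poly_ring (dim_col A)\<^esub> {monomial (pos_part u) - monomial (neg_part u) | u. u \<in> mat_kernel A}"

text \<open>Minimality is with respect to inclusion.\<close>

definition minimal_generating_set :: "nat \<Rightarrow> 'k::field mpoly set \<Rightarrow> 'k mpoly set \<Rightarrow> bool" where
  "minimal_generating_set n I S \<longleftrightarrow>
     S \<subseteq> carrier (poly_ring n) \<and> Idl\<^bsub>poly_ring n\<^esub> S = I \<and>
     (\<forall>T. T \<subset> S \<longrightarrow> Idl\<^bsub>poly_ring n\<^esub> T \<noteq> I)"

definition generic :: "nat \<Rightarrow> 'k::field mpoly set \<Rightarrow> bool" where
  "generic n I \<longleftrightarrow>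
     (\<exists>U. finite U \<and> U \<subseteq> carrier_vec n \<times> carrier_vec n \<and>
          (\<forall>(u, v) \<in> U. \<forall>i<n. int (u $ i) - int (v $ i) \<noteq> 0) \<and>
          minimal_generating_set n I {monomial u - monomial v | u v. (u, v) \<in> U})"

section \<open>Gale transforms\<close>

definition lattice_basis :: "nat \<Rightarrow> nat \<Rightarrow> int vec set \<Rightarrow> int mat \<Rightarrow> bool" where
  "lattice_basis n d L G \<longleftrightarrow>
     G \<in> carrier_mat n d \<and>
     {G *\<^sub>v x | x. x \<in> carrier_vec d} = L \<and>
     (\<forall>x \<in> carrier_vec d. G *\<^sub>v x = 0\<^sub>v n \<longrightarrow> x = 0\<^sub>v d)"

definition int_rank :: "int mat \<Rightarrow> nat" where
  "int_rank A = vec_space.rank (dim_row A) (map_mat rat_of_int A)"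

text \<open>The Gale vector of \<^term>\<open>col A i\<close> is \<^term>\<open>row G i\<close>.\<close>

definition gale_matrix :: "int mat \<Rightarrow> int mat \<Rightarrow> bool" where
  "gale_matrix A G \<longleftrightarrow> lattice_basis (dim_col A) (dim_col A - int_rank A) (mat_kernel A) G"

section \<open>Bouquets\<close>

definition supp :: "int vec \<Rightarrow> nat set" where
  "supp c = {i. i < dim_vec c \<and> c $ i \<noteq> 0}"

definition covectors :: "int mat \<Rightarrow> int vec set" where
  "covectors A = {vec (dim_col A) (\<lambda>i. v \<bullet> col A i) | v. v \<in> carrier_vec (dim_row A)}"

definition cocircuits :: "int mat \<Rightarrow> int vec set" where
  "cocircuits A = {c \<in> covectors A. supp c \<noteq> {} \<and>
     (\<forall>c' \<in> covectors A. supp c' \<noteq> {} \<longrightarrow> \<not> supp c' \<subset> supp c)}"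

definition free :: "int mat \<Rightarrow> nat \<Rightarrow> bool" where
  "free A i \<longleftrightarrow> (\<exists>c \<in> cocircuits A. supp c = {i})"

definition no_free_bouquet :: "int mat \<Rightarrow> bool" where
  "no_free_bouquet A \<longleftrightarrow> (\<forall>i<dim_col A. \<not> free A i)"

definition bouquet_edges :: "int mat \<Rightarrow> nat set set" where
  "bouquet_edges A = {{i, j} | i j. i \<noteq> j \<and> (\<exists>c \<in> covectors A. supp c = {i, j})}"

text \<open>The sign condition is meaningful only if \<open>A\<close> has no free vectors: then a co-vector with
  support \<open>{i, j}\<close> is a co-circuit, hence unique up to a scalar factor.\<close>

definition edges_plus :: "int mat \<Rightarrow> nat set set" where
  "edges_plus A = {{i, j} | i j. i \<noteq> j \<and>
     (\<exists>c \<in> covectors A. supp c = {i, j} \<and> sgn (c $ i) \<noteq> sgn (c $ j))}"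

definition bouquets :: "int mat \<Rightarrow> nat set set" where
  "bouquets A = {..<dim_col A} // {(i, j). {i, j} \<in> bouquet_edges A}\<^sup>*"

definition non_mixed :: "int mat \<Rightarrow> nat set \<Rightarrow> bool" where
  "non_mixed A B \<longleftrightarrow>
     is_singleton B \<or> (\<forall>e \<in> bouquet_edges A. e \<subseteq> B \<longrightarrow> e \<in> edges_plus A)"

definition stable_toric :: "int mat \<Rightarrow> bool" where
  "stable_toric A \<longleftrightarrow> (\<forall>B \<in> bouquets A. non_mixed A B)"

text \<open>The result does not depend on the choice of the coordinate \<open>j\<close>. It is meaningful only
  for non-free bouquets, where such a coordinate exists.\<close>

definition bouquet_c :: "int mat \<Rightarrow> nat set \<Rightarrow> int vec" where
  "bouquet_c G B =
     (let j = (SOME j. j < dim_col G \<and> (\<forall>i\<in>B. G $$ (i, j) \<noteq> 0));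
          g = Gcd ((\<lambda>i. G $$ (i, j)) ` B);
          \<epsilon> = sgn (G $$ (Min B, j))
      in vec (dim_row G) (\<lambda>i. if i \<in> B then (\<epsilon> * G $$ (i, j)) div g else 0))"

definition bouquet_a :: "int mat \<Rightarrow> int mat \<Rightarrow> nat set \<Rightarrow> int vec" where
  "bouquet_a A G B = A *\<^sub>v bouquet_c G B"

definition bouquet_matrix :: "int mat \<Rightarrow> int mat \<Rightarrow> nat set list \<Rightarrow> int mat" where
  "bouquet_matrix A G Bs = mat_of_cols (dim_row A) (map (bouquet_a A G) Bs)"

end

theory Submission
  imports Defs
begin

text \<open>Genericity is a property of the congruence on exponent vectors that the
  ideal defines. A difference of monomials \<open>x\<^sup>a - x\<^sup>b\<close> lies in the ideal generated by binomials
  \<open>x\<^sup>u - x\<^sup>v\<close> exactly if \<open>a\<close> and \<open>b\<close> are connected by moves \<open>t + u \<leftrightarrow> t + v\<close>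
  (\<open>monomial_diff_in_ideal_iff\<close>), and a finite generating set of binomials can be thinned out to a
  minimal one without losing full support. So \<open>I\<^sub>A\<close> is generic exactly if finitely many moves of
  full support connect precisely the pairs of exponent vectors that differ by an element of
  \<open>Ker\<^sub>\<int>(A)\<close>, that is, if there is a finite Markov basis of full support
  (\<open>generic_toric_iff_markov\<close>). This is a combinatorial property of the lattice \<open>Ker\<^sub>\<int>(A)\<close>.

  If there are no free vectors and no mixed bouquets, any two coordinates in the same bouquet are
  related on \<open>Ker\<^sub>\<int>(A)\<close> by a positive factor. Hence every \<open>c\<^sub>B\<close> is positive on \<open>B\<close>, and since it is
  also primitive, \<open>Ker\<^sub>\<int>(A)\<close> is the image of the kernel of the bouquet matrix under
  \<open>w \<mapsto> \<Sum>\<^sub>B w\<^sub>B c\<^sub>B\<close> (\<open>kernel_inflation\<close>). This map \<open>D\<close> and its restriction \<open>C\<close> to vectors of natural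
  numbers repeat the coordinate of each bouquet, with positive weights; therefore they preserve and
  reflect nonnegativity and commute with positive and negative parts.

  It remains to transport Markov bases along \<open>C\<close>. The images of a full basis for the bouquet matrix
  form one for \<open>A\<close> (\<open>full_markov_basis_inflate\<close>), because
  each \<open>u \<in> Ker\<^sub>\<int>(A)\<close> has \<open>u\<^sup>\<plusminus> = C w\<^sup>\<plusminus>\<close>. Conversely, the differences \<open>u - v\<close> of a full basis for
  \<open>A\<close> are of the form \<open>D w\<close>, and the pairs \<open>(w\<^sup>+, w\<^sup>-)\<close> form a full basis for the bouquet matrix
  (\<open>full_markov_basis_deflate\<close>): a path of moves between two vectors in the image of \<open>C\<close> never
  leaves this image, and it can be read off downstairs.\<close>

section \<open>Free vectors and the integer kernel\<close>

text \<open>Linear duality without division: a functional that vanishes on the common zeros of \<open>f\<^sub>0, \<dots>, f\<^bsub>m-1\<^esub>\<close>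
  has a nonzero multiple in their span. The induction on \<open>m\<close> replaces \<open>L\<close> by the kernel of the last
  functional; this is why the statement is about sublattices and not only about \<open>\<int>\<^sup>n\<close>.\<close>

lemma integer_functional_in_span:
  fixes f :: "nat \<Rightarrow> int vec \<Rightarrow> int" and g :: "int vec \<Rightarrow> int"
  assumes "L \<subseteq> carrier_vec n"
    and "\<And>x y a b. x \<in> L \<Longrightarrow> y \<in> L \<Longrightarrow> a \<cdot>\<^sub>v x + b \<cdot>\<^sub>v y \<in> L"
    and "\<And>k x y a b. x \<in> carrier_vec n \<Longrightarrow> y \<in> carrier_vec n \<Longrightarrow>
           f k (a \<cdot>\<^sub>v x + b \<cdot>\<^sub>v y) = a * f k x + b * f k y"
    and "\<And>x y a b. x \<in> carrier_vec n \<Longrightarrow> y \<in> carrier_vec n \<Longrightarrow>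
           g (a \<cdot>\<^sub>v x + b \<cdot>\<^sub>v y) = a * g x + b * g y"
    and "\<And>x. x \<in> L \<Longrightarrow> (\<forall>k<m. f k x = 0) \<Longrightarrow> g x = 0"
  shows "\<exists>c v. c \<noteq> 0 \<and> (\<forall>x\<in>L. c * g x = (\<Sum>k<m. v k * f k x))"
  using assms(1,2,5)
proof (induction m arbitrary: L)
  case 0
  then have "\<forall>x\<in>L. g x = 0" by auto
  then show ?case by (intro exI[of _ 1] exI) auto
next
  case (Suc m)
  define L' where "L' = {x \<in> L. f m x = 0}"
  have "\<exists>c v. c \<noteq> 0 \<and> (\<forall>x\<in>L'. c * g x = (\<Sum>k<m. v k * f k x))"
  proof (rule Suc.IH)
    show "L' \<subseteq> carrier_vec n" using Suc.prems(1) by (auto simp: L'_def)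
    show "a \<cdot>\<^sub>v x + b \<cdot>\<^sub>v y \<in> L'" if "x \<in> L'" "y \<in> L'" for x y a b
      using that Suc.prems(1,2) assms(3)[of x y m a b] by (auto simp: L'_def)
    show "g x = 0" if "x \<in> L'" "\<forall>k<m. f k x = 0" for x
      using that Suc.prems(3)[of x] by (auto simp: L'_def less_Suc_eq)
  qed
  then obtain c v where c: "c \<noteq> 0" and v: "\<And>x. x \<in> L' \<Longrightarrow> c * g x = (\<Sum>k<m. v k * f k x)"
    by blast
  show ?case
  proof (cases "\<forall>x\<in>L. f m x = 0")
    case True
    then have "\<forall>x\<in>L. c * g x = (\<Sum>k<Suc m. v k * f k x)"
      using v by (auto simp: L'_def)
    then show ?thesis using c by blast
  next
    case False
    then obtain z where z: "z \<in> L" "f m z \<noteq> 0" by auto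
    \<comment> \<open>\<open>h\<close> vanishes on \<open>L'\<close>, the zeros of \<open>f m\<close>, so it is a multiple of \<open>f m\<close> up to the factor \<open>f m z\<close>.\<close>
    define h where "h = (\<lambda>x. c * g x - (\<Sum>k<m. v k * f k x))"
    have h_lin: "h (a \<cdot>\<^sub>v x + b \<cdot>\<^sub>v y) = a * h x + b * h y"
      if "x \<in> carrier_vec n" "y \<in> carrier_vec n" for x y a b
      using that
      by (simp add: h_def assms(3,4) algebra_simps sum.distrib sum_distrib_left)
    have main: "f m z * h x = h z * f m x" if "x \<in> L" for x
    proof -
      let ?y = "f m z \<cdot>\<^sub>v x + (- f m x) \<cdot>\<^sub>v z"
      have car: "x \<in> carrier_vec n" "z \<in> carrier_vec n" using that z Suc.prems(1) by auto
      have "?y \<in> L" using that z Suc.prems(2) by blast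
      moreover have "f m ?y = 0" using assms(3)[OF car, of m "f m z" "- f m x"] by simp
      ultimately have "?y \<in> L'" by (simp add: L'_def)
      then have "h ?y = 0" using v by (simp add: h_def)
      then show ?thesis using h_lin[OF car, of "f m z" "- f m x"] by (simp add: algebra_simps)
    qed
    let ?v = "\<lambda>k. if k < m then f m z * v k else h z"
    have "f m z * c * g x = (\<Sum>k<Suc m. ?v k * f k x)" if "x \<in> L" for x
    proof -
      have "f m z * c * g x = f m z * (\<Sum>k<m. v k * f k x) + h z * f m x"
        using main[OF that] by (simp add: h_def algebra_simps)
      also have "\<dots> = (\<Sum>k<Suc m. ?v k * f k x)"
        by (simp add: sum_distrib_left mult.assoc)
      finally show ?thesis .
    qed
    moreover have "f m z * c \<noteq> 0" using z c by simp
    ultimately show ?thesis by (intro exI[of _ "f m z * c"] exI[of _ ?v]) simp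
  qed
qed

lemma covector_orthogonal_kernel:
  assumes "A \<in> carrier_mat m n" and "c \<in> covectors A" and "u \<in> mat_kernel A"
  shows "c \<bullet> u = 0"
proof -
  obtain v where v: "v \<in> carrier_vec m" "c = vec n (\<lambda>i. v \<bullet> col A i)"
    using assms by (auto simp: covectors_def)
  have u: "u \<in> carrier_vec n" "A *\<^sub>v u = 0\<^sub>v m"
    using assms by (auto simp: mat_kernel_def)
  have "c = transpose_mat A *\<^sub>v v"
    using assms v by (auto simp: intro!: eq_vecI comm_scalar_prod)
  then have "c \<bullet> u = v \<bullet> (A *\<^sub>v u)"
    using transpose_vec_mult_scalar[OF assms(1) u(1) v(1)] by simp
  then show ?thesis using u v by simp
qed

text \<open>If all kernel vectors were zero at \<open>i\<close>, duality would make a multiple of the \<open>i\<close>-th coordinate a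
  combination of the rows, hence a co-vector with support \<open>{i}\<close>.\<close>

lemma not_free_kernel_nonzero:
  assumes A: "A \<in> carrier_mat m n" and i: "i < n" and "\<not> free A i"
  obtains u where "u \<in> mat_kernel A" and "u $ i \<noteq> 0"
proof (rule ccontr)
  assume "\<not> thesis"
  then have ker: "\<And>u. u \<in> mat_kernel A \<Longrightarrow> u $ i = 0" using that by blast
  have "\<exists>c v. c \<noteq> 0 \<and>
     (\<forall>x\<in>carrier_vec n. c * (x $ i) = (\<Sum>k<m. v k * (row A k \<bullet> x)))"
  proof (rule integer_functional_in_span[of "carrier_vec n" n])
    show "row A k \<bullet> (a \<cdot>\<^sub>v x + b \<cdot>\<^sub>v y) = a * (row A k \<bullet> x) + b * (row A k \<bullet> y)"
      if "x \<in> carrier_vec n" "y \<in> carrier_vec n" for k x y a b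
      using that by (simp add: scalar_prod_def algebra_simps sum.distrib sum_distrib_left)
    show "x $ i = 0" if "x \<in> carrier_vec n" "\<forall>k<m. row A k \<bullet> x = 0" for x
    proof -
      have "A *\<^sub>v x = 0\<^sub>v m" using that A by (intro eq_vecI) auto
      then show ?thesis using ker[of x] that A by (auto simp: mat_kernel_def)
    qed
  qed (use i in auto)
  then obtain c v where c: "c \<noteq> 0" and
    v: "\<And>x. x \<in> carrier_vec n \<Longrightarrow> c * (x $ i) = (\<Sum>k<m. v k * (row A k \<bullet> x))" by blast
  let ?c = "vec n (\<lambda>j. vec m v \<bullet> col A j)"
  have co: "?c $ j = (if j = i then c else 0)" if "j < n" for j
  proof -
    have "row A k \<bullet> unit_vec n j = A $$ (k, j)" if "k < m" for k
      using that A \<open>j < n\<close> by (simp add: scalar_prod_right_unit)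
    then have "vec m v \<bullet> col A j = (\<Sum>k<m. v k * (row A k \<bullet> unit_vec n j))"
      using that A by (simp add: scalar_prod_def atLeast0LessThan)
    then show ?thesis using v[of "unit_vec n j"] that i by (auto simp: unit_vec_def)
  qed
  have "?c \<in> covectors A" using A by (auto simp: covectors_def)
  moreover have s: "supp ?c = {i}" using co c i by (auto simp: supp_def split: if_splits)
  ultimately have "?c \<in> cocircuits A" by (auto simp: cocircuits_def)
  then show False using s \<open>\<not> free A i\<close> unfolding free_def by blast
qed

section \<open>Ratios of kernel coordinates within a bouquet\<close>

definition pos_proportional :: "int vec set \<Rightarrow> nat \<Rightarrow> nat \<Rightarrow> bool" where
  "pos_proportional L i j \<longleftrightarrow> (\<exists>\<alpha> \<beta>. \<alpha> > 0 \<and> \<beta> > 0 \<and> (\<forall>u\<in>L. \<alpha> * u $ i = \<beta> * u $ j))"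

lemma pos_proportional_refl: "pos_proportional L i i"
  unfolding pos_proportional_def by (intro exI[of _ 1]) simp

lemma pos_proportional_trans:
  assumes "pos_proportional L i j" and "pos_proportional L j k"
  shows "pos_proportional L i k"
proof -
  obtain a b where ab: "a > 0" "b > 0" "\<forall>u\<in>L. a * u $ i = b * u $ j"
    using assms(1) by (auto simp: pos_proportional_def)
  obtain c d where cd: "c > 0" "d > 0" "\<forall>u\<in>L. c * u $ j = d * u $ k"
    using assms(2) by (auto simp: pos_proportional_def)
  have "(c * a) * u $ i = (b * d) * u $ k" if "u \<in> L" for u
  proof -
    have "(c * a) * u $ i = c * (b * u $ j)" using ab(3) that by (simp add: mult.assoc)
    also have "\<dots> = b * (c * u $ j)" by (simp add: algebra_simps)
    also have "\<dots> = (b * d) * u $ k" using cd(3) that by (simp add: mult.assoc)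
    finally show ?thesis .
  qed
  then show ?thesis unfolding pos_proportional_def using ab cd
    by (intro exI[of _ "c * a"] exI[of _ "b * d"]) auto
qed

lemma pos_proportional_sgn:
  assumes "pos_proportional L i j" and "u \<in> L"
  shows "sgn (u $ i) = sgn (u $ j)"
proof -
  obtain a b where "a > 0" "b > 0" "a * u $ i = b * u $ j"
    using assms by (auto simp: pos_proportional_def)
  then have "sgn a * sgn (u $ i) = sgn b * sgn (u $ j)" by (metis sgn_mult)
  then show ?thesis using \<open>a > 0\<close> \<open>b > 0\<close> by simp
qed

lemma pos_proportional_cross:
  assumes "pos_proportional L i j" and "u \<in> L" and "w \<in> L"
  shows "u $ i * w $ j = u $ j * w $ i"
proof -
  obtain a b where ab: "a > 0" "b > 0" "a * u $ i = b * u $ j" "a * w $ i = b * w $ j"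
    using assms by (auto simp: pos_proportional_def)
  have "a * b * (u $ i * w $ j) = a * b * (u $ j * w $ i)"
  proof -
    have "a * b * (u $ i * w $ j) = (a * u $ i) * (b * w $ j)" by (simp add: algebra_simps)
    also have "\<dots> = (b * u $ j) * (a * w $ i)" using ab(3,4) by simp
    also have "\<dots> = a * b * (u $ j * w $ i)" by (simp add: algebra_simps)
    finally show ?thesis .
  qed
  then show ?thesis using ab by simp
qed

text \<open>A co-vector with support \<open>{i, j}\<close> gives the relation \<open>c\<^sub>i u\<^sub>i + c\<^sub>j u\<^sub>j = 0\<close> for all kernel vectors \<open>u\<close>;
  opposite signs of \<open>c\<^sub>i\<close> and \<open>c\<^sub>j\<close> make the factor between \<open>u\<^sub>i\<close> and \<open>u\<^sub>j\<close> positive.\<close>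

lemma edges_plus_pos_proportional:
  assumes A: "A \<in> carrier_mat m n" and "{i, j} \<in> edges_plus A"
  shows "pos_proportional (mat_kernel A) i j"
proof -
  obtain p q c where e: "{i, j} = {p, q}" and "p \<noteq> q" and c: "c \<in> covectors A" "supp c = {p, q}"
    and "sgn (c $ p) \<noteq> sgn (c $ q)"
    using assms(2) unfolding edges_plus_def by blast
  then have ij: "i \<noteq> j" "supp c = {i, j}" and sg: "sgn (c $ i) \<noteq> sgn (c $ j)"
    by (auto simp: doubleton_eq_iff)
  have dim: "dim_vec c = n" using c A by (auto simp: covectors_def)
  have nz: "i < n" "j < n" "c $ i \<noteq> 0" "c $ j \<noteq> 0"
    using ij(2) dim by (auto simp: supp_def)
  have zero: "c $ k = 0" if "k < n" "k \<notin> {i, j}" for k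
    using that dim unfolding ij(2)[symmetric] by (simp add: supp_def)
  have orth: "c $ i * u $ i = - c $ j * u $ j" if u: "u \<in> mat_kernel A" for u
  proof -
    have "dim_vec u = n" using u A by (auto simp: mat_kernel_def)
    then have "0 = (\<Sum>k = 0..<n. c $ k * u $ k)"
      using covector_orthogonal_kernel[OF A c(1) u] by (simp add: scalar_prod_def)
    also have "\<dots> = (\<Sum>k\<in>{i, j}. c $ k * u $ k)"
      using nz zero by (intro sum.mono_neutral_right) auto
    also have "\<dots> = c $ i * u $ i + c $ j * u $ j" using ij by simp
    finally show ?thesis by simp
  qed
  show ?thesis
  proof (cases "c $ i > 0")
    case True
    then have "- c $ j > 0" using sg nz by (auto simp: sgn_if split: if_splits)
    then show ?thesis using True orth unfolding pos_proportional_def by blast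
  next
    case False
    then have "- c $ i > 0" "c $ j > 0" using sg nz by (auto simp: sgn_if split: if_splits)
    moreover have "\<forall>u\<in>mat_kernel A. - c $ i * u $ i = c $ j * u $ j" using orth by simp
    ultimately show ?thesis unfolding pos_proportional_def by blast
  qed
qed

lemma bouquet_edge_covector:
  assumes "e \<in> bouquet_edges A"
  shows "\<exists>c\<in>covectors A. supp c = e"
  using assms by (auto simp: bouquet_edges_def)

lemma bouquets_partition:
  assumes "A \<in> carrier_mat m n"
  shows "equiv UNIV ({(i, j). {i, j} \<in> bouquet_edges A}\<^sup>*)"
    and "\<Union> (bouquets A) = {..<n}"
    and "B \<in> bouquets A \<Longrightarrow> B \<noteq> {}"
    and "B \<in> bouquets A \<Longrightarrow> B' \<in> bouquets A \<Longrightarrow> i \<in> B \<Longrightarrow> i \<in> B' \<Longrightarrow> B = B'"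
proof -
  let ?R = "{(i, j). {i, j} \<in> bouquet_edges A}"
  have sym: "sym ?R" by (auto simp: sym_def insert_commute)
  show eq: "equiv UNIV (?R\<^sup>*)"
    using sym by (auto intro!: equivI refl_rtrancl sym_rtrancl trans_rtrancl)
  have bound: "j < n" if "(i, j) \<in> ?R" for i j
  proof -
    have "{i, j} \<in> bouquet_edges A" using that by simp
    then obtain c where "c \<in> covectors A" "supp c = {i, j}"
      using bouquet_edge_covector by blast
    then have "j \<in> supp c" "dim_vec c = n" using assms by (auto simp: covectors_def)
    then show ?thesis by (simp add: supp_def)
  qed
  have "j < n" if "(i, j) \<in> ?R\<^sup>*" "i < n" for i j
    using that by (induction rule: rtrancl_induct) (use bound in blast)+
  then show "\<Union> (bouquets A) = {..<n}"
    using assms by (auto simp: bouquets_def quotient_def)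
  show "B \<in> bouquets A \<Longrightarrow> B \<noteq> {}" by (auto simp: bouquets_def quotient_def)
  show "B = B'" if "B \<in> bouquets A" "B' \<in> bouquets A" "i \<in> B" "i \<in> B'"
  proof -
    have "B \<in> UNIV // ?R\<^sup>*" "B' \<in> UNIV // ?R\<^sup>*"
      using that by (auto simp: bouquets_def quotient_def)
    then show ?thesis using quotient_disj[OF eq] that by blast
  qed
qed

text \<open>Two members of a bouquet are joined by a path that stays in the bouquet, and each of its edges
  has a positive factor.\<close>

lemma stable_bouquet_pos_proportional:
  assumes A: "A \<in> carrier_mat m n" and "stable_toric A"
    and B: "B \<in> bouquets A" and "i \<in> B" "j \<in> B"
  shows "pos_proportional (mat_kernel A) i j"
proof -
  let ?R = "{(i, j). {i, j} \<in> bouquet_edges A}"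
  note eq = bouquets_partition(1)[OF A]
  have Bq: "B \<in> UNIV // ?R\<^sup>*" using B by (auto simp: bouquets_def quotient_def)
  have nm: "non_mixed A B" using assms by (simp add: stable_toric_def)
  have "(i, j) \<in> ?R\<^sup>*" using quotient_eq_iff[OF eq Bq Bq] assms(4,5) by blast
  then show ?thesis
  proof (induction rule: rtrancl_induct)
    case base
    show ?case by (rule pos_proportional_refl)
  next
    case (step y z)
    have y: "y \<in> B" using in_quotient_imp_closed[OF eq Bq \<open>i \<in> B\<close> step(1)] .
    have z: "z \<in> B" using in_quotient_imp_closed[OF eq Bq y] step(2) by blast
    have edge: "{y, z} \<in> bouquet_edges A" using step(2) by simp
    have "y \<noteq> z" using edge by (auto simp: bouquet_edges_def doubleton_eq_iff)
    then have "\<not> is_singleton B" using y z by (auto simp: is_singleton_def)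
    then have "{y, z} \<in> edges_plus A" using nm edge y z by (auto simp: non_mixed_def)
    then show ?case using step(3) edges_plus_pos_proportional[OF A] pos_proportional_trans by blast
  qed
qed

text \<open>The last property is the integrality statement that makes the bouquet matrix have the right kernel:
  on \<open>B\<close>, each kernel vector is an integer multiple of \<open>c\<^sub>B\<close>, because it is proportional
  to \<open>c\<^sub>B\<close> and the entries of \<open>c\<^sub>B\<close> have no common divisor.\<close>

lemma bouquet_c_properties:
  assumes A: "A \<in> carrier_mat m n" and G: "gale_matrix A G" and nf: "no_free_bouquet A"
    and st: "stable_toric A" and B: "B \<in> bouquets A"
  shows "bouquet_c G B \<in> carrier_vec n"
    and "i \<in> B \<Longrightarrow> bouquet_c G B $ i > 0"
    and "i < n \<Longrightarrow> i \<notin> B \<Longrightarrow> bouquet_c G B $ i = 0"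
    and "u \<in> mat_kernel A \<Longrightarrow> \<exists>w. \<forall>i\<in>B. u $ i = bouquet_c G B $ i * w"
proof -
  define d where "d = n - int_rank A"
  have G': "G \<in> carrier_mat n d" and ker: "{G *\<^sub>v x | x. x \<in> carrier_vec d} = mat_kernel A"
    using A G by (simp_all add: gale_matrix_def lattice_basis_def d_def)
  have im: "u \<in> mat_kernel A \<longleftrightarrow> (\<exists>x. u = G *\<^sub>v x \<and> x \<in> carrier_vec d)" for u
    unfolding ker[symmetric] by simp
  have Bn: "B \<subseteq> {..<n}" "B \<noteq> {}" using bouquets_partition[OF A] B by auto
  then have finB: "finite B" using finite_subset by blast
  have colG: "col G j \<in> mat_kernel A" if "j < d" for j
  proof -
    have "G *\<^sub>v unit_vec d j = col G j" using G' that by (intro eq_vecI) auto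
    then have "col G j = G *\<^sub>v unit_vec d j" by simp
    then show ?thesis using im[of "col G j"] unit_vec_carrier[of d j] by blast
  qed
  have cross: "u $ i * w $ k = u $ k * w $ i"
    if "i \<in> B" "k \<in> B" "u \<in> mat_kernel A" "w \<in> mat_kernel A" for i k u w
    using pos_proportional_cross[OF stable_bouquet_pos_proportional[OF A st B that(1,2)] that(3,4)] .
  have sgn: "sgn (u $ i) = sgn (u $ k)" if "i \<in> B" "k \<in> B" "u \<in> mat_kernel A" for i k u
    using pos_proportional_sgn[OF stable_bouquet_pos_proportional[OF A st B that(1,2)] that(3)] .
  have G_entry: "G $$ (i, j) = col G j $ i" if "i \<in> B" "j < d" for i j
    using that Bn G' by auto
  have ex: "\<exists>j. j < dim_col G \<and> (\<forall>i\<in>B. G $$ (i, j) \<noteq> 0)"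
  proof -
    obtain i0 where i0: "i0 \<in> B" using Bn by blast
    then have "\<not> free A i0" using nf A Bn by (auto simp: no_free_bouquet_def)
    then obtain u where u: "u \<in> mat_kernel A" "u $ i0 \<noteq> 0"
      using not_free_kernel_nonzero[OF A, of i0] i0 Bn by blast
    then obtain x where x: "x \<in> carrier_vec d" "u = G *\<^sub>v x" using im[of u] by blast
    have "\<exists>j<d. G $$ (i0, j) \<noteq> 0"
    proof (rule ccontr)
      assume "\<not> ?thesis"
      then have "u $ i0 = 0" using x i0 Bn G' by (auto simp: scalar_prod_def)
      then show False using u by simp
    qed
    then obtain j where j: "j < d" "G $$ (i0, j) \<noteq> 0" by blast
    have "G $$ (i, j) \<noteq> 0" if "i \<in> B" for i
      using sgn[OF that i0 colG[OF j(1)]] j G_entry that i0 by (metis sgn_eq_0_iff)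
    then show ?thesis using j G' by auto
  qed
  define j where "j = (SOME j. j < dim_col G \<and> (\<forall>i\<in>B. G $$ (i, j) \<noteq> 0))"
  have j: "j < d" and nz: "\<And>i. i \<in> B \<Longrightarrow> G $$ (i, j) \<noteq> 0"
    using someI_ex[OF ex] G' by (auto simp: j_def)
  define g where "g = Gcd ((\<lambda>i. G $$ (i, j)) ` B)"
  define e where "e = sgn (G $$ (Min B, j))"
  have c_def: "bouquet_c G B = vec n (\<lambda>i. if i \<in> B then (e * G $$ (i, j)) div g else 0)"
    using G' unfolding bouquet_c_def g_def e_def j_def Let_def by simp
  have minB: "Min B \<in> B" using finB Bn by simp
  have e: "e * G $$ (i, j) = \<bar>G $$ (i, j)\<bar>" if "i \<in> B" for i
    using sgn[OF minB that colG[OF j]] G_entry[OF minB j] G_entry[OF that j]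
    by (simp add: e_def abs_sgn mult.commute)
  have g_dvd: "g dvd G $$ (i, j)" if "i \<in> B" for i
    using that by (auto simp: g_def)
  have "g \<noteq> 0" using g_dvd[OF minB] nz[OF minB] by auto
  then have g: "g > 0" using Gcd_int_greater_eq_0[of "(\<lambda>i. G $$ (i, j)) ` B"] unfolding g_def by linarith
  let ?c = "bouquet_c G B"
  have cB: "?c $ i * g = \<bar>G $$ (i, j)\<bar>" if "i \<in> B" for i
    using that Bn g_dvd[OF that] by (auto simp: c_def e)
  show "?c \<in> carrier_vec n" by (simp add: c_def)
  show pos: "?c $ i > 0" if "i \<in> B" for i
  proof -
    have "?c $ i * g > 0" using cB[OF that] nz[OF that] by simp
    then show ?thesis using g by (simp add: zero_less_mult_iff)
  qed
  show "?c $ i = 0" if "i < n" "i \<notin> B" using that by (simp add: c_def)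
  show "\<exists>w. \<forall>i\<in>B. u $ i = ?c $ i * w" if u: "u \<in> mat_kernel A"
  proof -
    let ?b = "Min B"
    have cr: "u $ i * G $$ (k, j) = u $ k * G $$ (i, j)" if "i \<in> B" "k \<in> B" for i k
      using cross[OF that u colG[OF j]] G_entry that j by simp
    \<comment> \<open>Primitivity of \<open>c\<^sub>B\<close>: \<open>G\<^sub>b\<^sub>j\<close> divides all \<open>u\<^sub>b G\<^sub>i\<^sub>j = u\<^sub>i G\<^sub>b\<^sub>j\<close>, hence \<open>u\<^sub>b\<close> times their gcd.\<close>
    have "G $$ (?b, j) dvd u $ ?b * g"
    proof -
      have "G $$ (?b, j) dvd Gcd ((*) (u $ ?b) ` ((\<lambda>i. G $$ (i, j)) ` B))"
        using cr[OF minB] by (intro Gcd_greatest) auto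
      then show ?thesis by (simp add: Gcd_mult g_def)
    qed
    then have "?c $ ?b * g dvd u $ ?b * g" using cB[OF minB] by simp
    then have "?c $ ?b dvd u $ ?b" using g by simp
    then obtain w where w: "u $ ?b = ?c $ ?b * w" by blast
    have "u $ i = ?c $ i * w" if "i \<in> B" for i
    proof -
      have "u $ i * (?c $ ?b * g) = u $ ?b * (?c $ i * g)"
      proof -
        have "u $ i * (e * G $$ (?b, j)) = u $ ?b * (e * G $$ (i, j))"
          using cr[OF that minB] by (simp add: mult.left_commute)
        then show ?thesis using cB that minB e by simp
      qed
      then have "?c $ ?b * g * (u $ i) = ?c $ ?b * g * (?c $ i * w)"
        using w by (simp add: algebra_simps)
      moreover have "?c $ ?b * g \<noteq> 0" using pos[OF minB] g by simp
      ultimately show ?thesis by (metis mult_left_cancel)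
    qed
    then show ?thesis by blast
  qed
qed

section \<open>The kernel as an inflation of the kernel of the bouquet matrix\<close>

text \<open>The map \<open>w \<mapsto> \<Sum>\<^sub>k w\<^sub>k c\<^sub>k\<close> for vectors \<open>c\<^sub>k\<close> with disjoint supports that cover all coordinates: \<open>\<beta> i\<close>
  is the index of the block that contains \<open>i\<close>, and \<open>d i\<close> is the \<open>i\<close>-th entry of its vector. The
  entry type is left open because exponent vectors and kernel vectors are both inflated.\<close>

definition inflate :: "nat \<Rightarrow> (nat \<Rightarrow> nat) \<Rightarrow> (nat \<Rightarrow> 'a::times) \<Rightarrow> 'a vec \<Rightarrow> 'a vec" where
  "inflate n \<beta> d w = vec n (\<lambda>i. d i * w $ \<beta> i)"

text \<open>The bouquet matrix is \<open>A\<close> times the matrix with columns \<open>c\<^sub>B\<close>, so its kernel is the preimage of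
  \<open>Ker\<^sub>\<int>(A)\<close> under inflation. All of \<open>Ker\<^sub>\<int>(A)\<close> is reached since each kernel vector restricts on
  every bouquet to an integer multiple of \<open>c\<^sub>B\<close>.\<close>

lemma kernel_inflation:
  assumes A: "A \<in> carrier_mat m n" and G: "gale_matrix A G" and nf: "no_free_bouquet A"
    and Bs: "distinct Bs" "set Bs = bouquets A"
    and st: "stable_toric A"
  obtains \<beta> :: "nat \<Rightarrow> nat" and d :: "nat \<Rightarrow> nat"
  where "\<beta> ` {..<n} = {..<length Bs}" and "\<And>i. i < n \<Longrightarrow> d i > 0"
    and "mat_kernel A = inflate n \<beta> (\<lambda>i. int (d i)) ` mat_kernel (bouquet_matrix A G Bs)"
proof -
  let ?s = "length Bs" and ?AB = "bouquet_matrix A G Bs"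
  note P = bouquets_partition[OF A] and C = bouquet_c_properties[OF A G nf st]
  have Bk: "Bs ! k \<in> bouquets A" if "k < ?s" for k using Bs that by (metis nth_mem)
  have "\<exists>k<?s. i \<in> Bs ! k" if "i < n" for i
    using P(2) that Bs(2) by (metis UnionE in_set_conv_nth lessThan_iff)
  then obtain \<beta> where \<beta>: "\<And>i. i < n \<Longrightarrow> \<beta> i < ?s" "\<And>i. i < n \<Longrightarrow> i \<in> Bs ! \<beta> i" by metis
  have \<beta>_unique: "k = \<beta> i" if "i < n" "k < ?s" "i \<in> Bs ! k" for i k
    using P(4)[OF Bk[OF that(2)] Bk[OF \<beta>(1)[OF that(1)]] that(3) \<beta>(2)[OF that(1)]]
      Bs(1) that \<beta>(1) by (simp add: nth_eq_iff_index_eq)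
  have surj: "\<beta> ` {..<n} = {..<?s}"
  proof (intro equalityI subsetI)
    fix k assume "k \<in> {..<?s}"
    then have k: "k < ?s" by simp
    then obtain i where i: "i \<in> Bs ! k" using P(3)[OF Bk] by blast
    then have "i < n" using P(2) Bk[OF k] by blast
    then show "k \<in> \<beta> ` {..<n}" using \<beta>_unique k i by blast
  qed (use \<beta> in auto)
  let ?c = "\<lambda>k. bouquet_c G (Bs ! k)"
  define d where "d i = nat (?c (\<beta> i) $ i)" for i
  have d: "int (d i) = ?c (\<beta> i) $ i" "d i > 0" if "i < n" for i
    using C(2)[OF Bk[OF \<beta>(1)[OF that]] \<beta>(2)[OF that]] by (auto simp: d_def)
  let ?C = "mat_of_cols n (map (bouquet_c G) Bs)"
  have Ccar: "?C \<in> carrier_mat n ?s"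
    using mat_of_cols_carrier(1)[of n "map (bouquet_c G) Bs"] by simp
  have C_mult: "?C *\<^sub>v w = inflate n \<beta> (\<lambda>i. int (d i)) w" if w: "w \<in> carrier_vec ?s" for w
  proof (intro eq_vecI)
    fix i assume "i < dim_vec (inflate n \<beta> (\<lambda>i. int (d i)) w)"
    then have i: "i < n" by (simp add: inflate_def)
    have "(?C *\<^sub>v w) $ i = (\<Sum>k = 0..<?s. ?c k $ i * w $ k)"
      using i w by (auto simp: scalar_prod_def mat_of_cols_index intro!: sum.cong)
    also have "\<dots> = (\<Sum>k\<in>{\<beta> i}. ?c k $ i * w $ k)"
    proof (rule sum.mono_neutral_right)
      show "\<forall>k\<in>{0..<?s} - {\<beta> i}. ?c k $ i * w $ k = 0"
      proof
        fix k assume "k \<in> {0..<?s} - {\<beta> i}"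
        then have k: "k < ?s" "k \<noteq> \<beta> i" by auto
        then have "i \<notin> Bs ! k" using \<beta>_unique[OF i] by blast
        then show "?c k $ i * w $ k = 0" using C(3)[OF Bk[OF k(1)] i] by simp
      qed
    qed (use \<beta> i in auto)
    finally show "(?C *\<^sub>v w) $ i = inflate n \<beta> (\<lambda>i. int (d i)) w $ i"
      using i d by (simp add: inflate_def)
  qed (simp add: inflate_def)
  have AB: "?AB = A * ?C"
  proof (rule eq_matI)
    fix i k assume "i < dim_row (A * ?C)" "k < dim_col (A * ?C)"
    moreover from this have "col ?C k = ?c k"
      using C(1)[OF Bk] by (intro eq_vecI) (auto simp: mat_of_cols_index)
    ultimately show "?AB $$ (i, k) = (A * ?C) $$ (i, k)"
      using A by (simp add: bouquet_matrix_def mat_of_cols_index bouquet_a_def)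
  qed (auto simp: bouquet_matrix_def)
  have ker_AB: "w \<in> mat_kernel ?AB \<longleftrightarrow>
      w \<in> carrier_vec ?s \<and> inflate n \<beta> (\<lambda>i. int (d i)) w \<in> mat_kernel A" for w
    using A assoc_mult_mat_vec[OF A Ccar, of w] C_mult[of w]
    by (auto simp: mat_kernel_def AB inflate_def)
  have "u \<in> inflate n \<beta> (\<lambda>i. int (d i)) ` mat_kernel ?AB" if u: "u \<in> mat_kernel A" for u
  proof -
    have "\<exists>w. \<forall>i\<in>Bs ! k. u $ i = ?c k $ i * w" if "k < ?s" for k
      using C(4)[OF Bk[OF that] u] .
    then obtain w where w: "\<And>k i. k < ?s \<Longrightarrow> i \<in> Bs ! k \<Longrightarrow> u $ i = ?c k $ i * w k" by metis
    have "dim_vec u = n" using u A by (auto simp: mat_kernel_def)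
    then have "u = inflate n \<beta> (\<lambda>i. int (d i)) (vec ?s w)"
      using w \<beta> d by (intro eq_vecI) (auto simp: inflate_def)
    then show ?thesis using u ker_AB by (intro image_eqI[of _ _ "vec ?s w"]) auto
  qed
  then have "mat_kernel A = inflate n \<beta> (\<lambda>i. int (d i)) ` mat_kernel ?AB" using ker_AB by blast
  then show thesis using that surj d by blast
qed

section \<open>Binomial ideals and moves on exponent vectors\<close>

definition exponent :: "nat vec \<Rightarrow> (nat \<Rightarrow>\<^sub>0 nat)" where
  "exponent u = (\<Sum>i<dim_vec u. Poly_Mapping.single i (u $ i))"

lemma monomial_eq: "monomial u = Poly_Mapping.single (exponent u) 1"
  by (simp add: monomial_def exponent_def)

lemma lookup_exponent: "Poly_Mapping.lookup (exponent u) i = (if i < dim_vec u then u $ i else 0)"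
  by (simp add: exponent_def lookup_sum lookup_single when_def)

lemma exponent_add:
  assumes "u \<in> carrier_vec n" and "v \<in> carrier_vec n"
  shows "exponent (u + v) = exponent u + exponent v"
  using assms by (intro poly_mapping_eqI) (auto simp: lookup_exponent lookup_add)

lemma vec_lookup_exponent:
  assumes "u \<in> carrier_vec n"
  shows "vec n (Poly_Mapping.lookup (exponent u)) = u"
  using assms by (intro eq_vecI) (auto simp: lookup_exponent)

lemma monomial_add:
  assumes "u \<in> carrier_vec n" and "v \<in> carrier_vec n"
  shows "(monomial (u + v) :: 'k::field mpoly) = monomial u * monomial v"
  using assms by (simp add: monomial_eq exponent_add mult_single)

lemma monomial_in_poly_ring:
  assumes "u \<in> carrier_vec n"
  shows "(monomial u :: 'k::field mpoly) \<in> carrier (poly_ring n)"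
  using assms
  by (auto simp: poly_ring_def monomial_eq in_keys_iff lookup_exponent split: if_splits)

lemma poly_ring_closed:
  "p \<in> carrier (poly_ring n) \<Longrightarrow> q \<in> carrier (poly_ring n) \<Longrightarrow> p + q \<in> carrier (poly_ring n)"
  "p \<in> carrier (poly_ring n) \<Longrightarrow> q \<in> carrier (poly_ring n) \<Longrightarrow> p * q \<in> carrier (poly_ring n)"
  "p \<in> carrier (poly_ring n) \<Longrightarrow> - p \<in> carrier (poly_ring n)"
proof -
  show "p + q \<in> carrier (poly_ring n)" if "p \<in> carrier (poly_ring n)" "q \<in> carrier (poly_ring n)"
    using that keys_add[of p q] unfolding poly_ring_def by fastforce
  show "- p \<in> carrier (poly_ring n)" if "p \<in> carrier (poly_ring n)"
    using that by (simp add: poly_ring_def)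
  show "p * q \<in> carrier (poly_ring n)" if "p \<in> carrier (poly_ring n)" "q \<in> carrier (poly_ring n)"
    unfolding poly_ring_def
  proof (simp, intro ballI)
    fix t assume "t \<in> Poly_Mapping.keys (p * q)"
    then obtain a b where "a \<in> Poly_Mapping.keys p" "b \<in> Poly_Mapping.keys q" "t = a + b"
      using keys_mult[of p q] by blast
    then show "Poly_Mapping.keys t \<subseteq> {..<n}"
      using that keys_add[of a b] by (fastforce simp: poly_ring_def)
  qed
qed

lemma poly_ring_consts:
  "0 \<in> carrier (poly_ring n :: 'k::field mpoly ring)"
  "1 \<in> carrier (poly_ring n :: 'k::field mpoly ring)"
  by (simp_all add: poly_ring_def)

lemma poly_ring_ops:
  "p \<oplus>\<^bsub>poly_ring n\<^esub> q = p + q"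
  "p \<otimes>\<^bsub>poly_ring n\<^esub> q = p * q"
  "\<zero>\<^bsub>poly_ring n :: 'k::field mpoly ring\<^esub> = 0"
  "\<one>\<^bsub>poly_ring n :: 'k::field mpoly ring\<^esub> = 1"
  by (simp_all add: poly_ring_def)

lemma poly_ring_cring: "cring (poly_ring n :: 'k::field mpoly ring)"
proof (rule cringI)
  show "abelian_group (poly_ring n :: 'k mpoly ring)"
  proof (rule abelian_groupI)
    show "\<exists>q\<in>carrier (poly_ring n). q \<oplus>\<^bsub>poly_ring n\<^esub> p = \<zero>\<^bsub>poly_ring n\<^esub>"
      if "p \<in> carrier (poly_ring n)" for p :: "'k mpoly"
      using poly_ring_closed(3)[OF that] by (intro bexI[of _ "- p"]) (simp_all add: poly_ring_ops)
  qed (simp_all add: poly_ring_ops poly_ring_closed poly_ring_consts algebra_simps)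
  show "comm_monoid (poly_ring n :: 'k mpoly ring)"
    by (rule comm_monoidI)
      (simp_all add: poly_ring_ops poly_ring_closed poly_ring_consts algebra_simps)
qed (simp add: poly_ring_ops algebra_simps)

definition binomials :: "(nat vec \<times> nat vec) set \<Rightarrow> 'k::field mpoly set" where
  "binomials U = {monomial u - monomial v | u v. (u, v) \<in> U}"

lemma binomials_in_poly_ring:
  assumes "U \<subseteq> carrier_vec n \<times> carrier_vec n"
  shows "binomials U \<subseteq> carrier (poly_ring n :: 'k::field mpoly ring)"
proof
  fix p :: "'k mpoly" assume "p \<in> binomials U"
  then obtain u v where uv: "(u, v) \<in> U" "p = monomial u - monomial v"
    by (auto simp: binomials_def)
  then have "u \<in> carrier_vec n" "v \<in> carrier_vec n" using assms by auto
  then have "monomial u + - monomial v \<in> carrier (poly_ring n :: 'k mpoly ring)"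
    using monomial_in_poly_ring poly_ring_closed by metis
  then show "p \<in> carrier (poly_ring n)" using uv by simp
qed

definition move :: "nat \<Rightarrow> (nat vec \<times> nat vec) set \<Rightarrow> nat vec \<Rightarrow> nat vec \<Rightarrow> bool" where
  "move n U a b \<longleftrightarrow> (\<exists>t u v. t \<in> carrier_vec n \<and> (u, v) \<in> U \<and> a = t + u \<and> b = t + v)"

lemma move_generator:
  assumes "U \<subseteq> carrier_vec n \<times> carrier_vec n" and "(u, v) \<in> U"
  shows "move n U u v"
proof -
  have "u \<in> carrier_vec n" "v \<in> carrier_vec n" using assms by auto
  then show ?thesis using assms(2) unfolding move_def
    by (intro exI[of _ "0\<^sub>v n"] exI[of _ u] exI[of _ v]) auto
qed

lemma equivclp_map:
  assumes "equivclp r a b" and "\<And>a b. r a b \<Longrightarrow> r' (f a) (f b)"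
  shows "equivclp r' (f a) (f b)"
  using assms(1)
proof (induction rule: equivclp_induct)
  case base
  show ?case by simp
next
  case (step y z)
  then have "equivclp r' (f y) (f z)"
    using assms(2) r_into_equivclp equivclp_sym by metis
  then show ?case using step(3) equivclp_trans by metis
qed

lemma move_translate:
  assumes "U \<subseteq> carrier_vec n \<times> carrier_vec n" and "t \<in> carrier_vec n" and "move n U a b"
  shows "move n U (t + a) (t + b)"
proof -
  obtain s u v where s: "s \<in> carrier_vec n" "(u, v) \<in> U" "a = s + u" "b = s + v"
    using assms(3) by (auto simp: move_def)
  then have "u \<in> carrier_vec n" "v \<in> carrier_vec n" using assms(1) by auto
  then show ?thesis using s assms(2) unfolding move_def
    by (intro exI[of _ "t + s"] exI[of _ u] exI[of _ v]) (auto simp: assoc_add_vec[of _ n])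
qed

text \<open>The \<open>K\<close>-linear functional on polynomials that takes the value \<open>f a\<close> at \<open>x\<^sup>a\<close> for each \<open>a \<in> \<nat>\<^sup>n\<close>. Such
  functionals, with \<open>f\<close> constant along moves, separate the monomials that are not connected.\<close>

definition weighted_sum :: "nat \<Rightarrow> (nat vec \<Rightarrow> 'k) \<Rightarrow> 'k::field mpoly \<Rightarrow> 'k" where
  "weighted_sum n f p = (\<Sum>t\<in>Poly_Mapping.keys p. Poly_Mapping.lookup p t * f (vec n (Poly_Mapping.lookup t)))"

lemma weighted_sum_superset:
  assumes "finite T" and "Poly_Mapping.keys p \<subseteq> T"
  shows "weighted_sum n f p = (\<Sum>t\<in>T. Poly_Mapping.lookup p t * f (vec n (Poly_Mapping.lookup t)))"
  unfolding weighted_sum_def using assms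
  by (intro sum.mono_neutral_left) (auto simp: in_keys_iff)

lemma weighted_sum_add: "weighted_sum n f (p + q) = weighted_sum n f p + weighted_sum n f q"
proof -
  let ?T = "Poly_Mapping.keys p \<union> Poly_Mapping.keys q"
  have "weighted_sum n f (p + q) = (\<Sum>t\<in>?T. Poly_Mapping.lookup (p + q) t * f (vec n (Poly_Mapping.lookup t)))"
    using keys_add[of p q] by (intro weighted_sum_superset) auto
  also have "\<dots> = (\<Sum>t\<in>?T. Poly_Mapping.lookup p t * f (vec n (Poly_Mapping.lookup t)))
                + (\<Sum>t\<in>?T. Poly_Mapping.lookup q t * f (vec n (Poly_Mapping.lookup t)))"
    by (simp add: lookup_add algebra_simps sum.distrib)
  also have "\<dots> = weighted_sum n f p + weighted_sum n f q"
    by (simp add: weighted_sum_superset[of ?T])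
  finally show ?thesis .
qed

lemma weighted_sum_single:
  "weighted_sum n f (Poly_Mapping.single t c) = c * f (vec n (Poly_Mapping.lookup t))"
  by (simp add: weighted_sum_def)

lemma weighted_sum_uminus: "weighted_sum n f (- p) = - weighted_sum n f p"
  by (simp add: weighted_sum_def sum_negf)

lemma weighted_sum_sum:
  "finite I \<Longrightarrow> weighted_sum n f (\<Sum>i\<in>I. p i) = (\<Sum>i\<in>I. weighted_sum n f (p i))"
  by (induction I rule: finite_induct) (simp_all add: weighted_sum_add, simp add: weighted_sum_def)

lemma weighted_sum_single_mult:
  "weighted_sum n f (Poly_Mapping.single s c * p) =
     c * weighted_sum n (\<lambda>b. f (vec n (Poly_Mapping.lookup s) + b)) p"
proof -
  have "p = (\<Sum>t\<in>Poly_Mapping.keys p. Poly_Mapping.single t (Poly_Mapping.lookup p t))"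
    by (intro poly_mapping_eqI)
      (auto simp: lookup_sum lookup_single when_def in_keys_iff sum.delta)
  then have "Poly_Mapping.single s c * p =
      (\<Sum>t\<in>Poly_Mapping.keys p. Poly_Mapping.single (s + t) (c * Poly_Mapping.lookup p t))"
    by (metis (no_types, lifting) mult_single sum.cong sum_distrib_left)
  then have "weighted_sum n f (Poly_Mapping.single s c * p) =
      (\<Sum>t\<in>Poly_Mapping.keys p. (c * Poly_Mapping.lookup p t) * f (vec n (Poly_Mapping.lookup (s + t))))"
    by (simp add: weighted_sum_sum weighted_sum_single)
  moreover have "vec n (Poly_Mapping.lookup (s + t)) = vec n (Poly_Mapping.lookup s) + vec n (Poly_Mapping.lookup t)" for t
    by (intro eq_vecI) (auto simp: lookup_add)
  ultimately show ?thesis by (simp add: weighted_sum_def sum_distrib_left mult.assoc)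
qed

lemma weighted_sum_mult:
  "weighted_sum n f (q * p) =
     (\<Sum>s\<in>Poly_Mapping.keys q. Poly_Mapping.lookup q s * weighted_sum n (\<lambda>b. f (vec n (Poly_Mapping.lookup s) + b)) p)"
proof -
  have "q = (\<Sum>s\<in>Poly_Mapping.keys q. Poly_Mapping.single s (Poly_Mapping.lookup q s))"
    by (intro poly_mapping_eqI)
      (auto simp: lookup_sum lookup_single when_def in_keys_iff sum.delta)
  then have "q * p = (\<Sum>s\<in>Poly_Mapping.keys q. Poly_Mapping.single s (Poly_Mapping.lookup q s) * p)"
    by (metis sum_distrib_right)
  then show ?thesis by (simp add: weighted_sum_sum weighted_sum_single_mult)
qed

lemma weighted_sum_monomial:
  assumes "u \<in> carrier_vec n"
  shows "weighted_sum n f (monomial u) = f u"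
  using assms by (simp add: monomial_eq weighted_sum_single vec_lookup_exponent)

text \<open>The polynomials that are annihilated by all functionals with weights constant along moves form an
  ideal: multiplication by \<open>x\<^sup>s\<close> only shifts the weight, and a shifted weight is again constant along
  moves. For this the quantifier over all such weights has to be part of the ideal.\<close>

lemma weighted_sum_ideal:
  assumes U: "U \<subseteq> carrier_vec n \<times> carrier_vec n"
    and p: "p \<in> Idl\<^bsub>poly_ring n\<^esub> (binomials U)"
    and f: "\<And>a b. move n U a b \<Longrightarrow> f a = f b"
  shows "weighted_sum n f p = 0"
proof -
  let ?R = "poly_ring n :: 'a mpoly ring"
  interpret R: cring ?R by (rule poly_ring_cring)
  define J where "J = {p \<in> carrier ?R.
     \<forall>f. (\<forall>a b. move n U a b \<longrightarrow> f a = f b) \<longrightarrow> weighted_sum n f p = 0}"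
  have mult: "q * p \<in> J" if "p \<in> J" "q \<in> carrier ?R" for p q
  proof -
    have "weighted_sum n f (q * p) = 0" if "\<forall>a b. move n U a b \<longrightarrow> f a = f b" for f
    proof -
      have "\<forall>a b. move n U a b \<longrightarrow> f (vec n (Poly_Mapping.lookup s) + a) = f (vec n (Poly_Mapping.lookup s) + b)" for s
        using that move_translate[OF U, of "vec n (Poly_Mapping.lookup s)"] by auto
      then have "weighted_sum n (\<lambda>b. f (vec n (Poly_Mapping.lookup s) + b)) p = 0" for s
        using \<open>p \<in> J\<close> by (simp add: J_def)
      then show ?thesis by (simp add: weighted_sum_mult)
    qed
    then show ?thesis using that poly_ring_closed(2) by (auto simp: J_def)
  qed
  have "ideal J ?R"
  proof (rule idealI)
    show "ring ?R" by (rule R.ring_axioms)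
    show "subgroup J (add_monoid ?R)"
    proof (rule R.add.subgroupI)
      show "J \<subseteq> carrier ?R" by (auto simp: J_def)
      have "0 \<in> J" by (simp add: J_def poly_ring_def weighted_sum_def)
      then show "J \<noteq> {}" by blast
      show "\<ominus>\<^bsub>?R\<^esub> p \<in> J" if "p \<in> J" for p
      proof -
        have "p \<in> carrier ?R" using that by (simp add: J_def)
        then have "\<ominus>\<^bsub>?R\<^esub> p = - p"
          using poly_ring_closed(3) by (intro R.minus_equality) (auto simp: poly_ring_def)
        moreover have "- p \<in> J"
          using that poly_ring_closed(3) by (auto simp: J_def weighted_sum_uminus)
        ultimately show ?thesis by simp
      qed
      show "p \<oplus>\<^bsub>?R\<^esub> q \<in> J" if "p \<in> J" "q \<in> J" for p q
      proof -
        have "p + q \<in> J" using that poly_ring_closed(1) by (auto simp: J_def weighted_sum_add)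
        then show ?thesis by (simp add: poly_ring_def)
      qed
    qed
    show "q \<otimes>\<^bsub>?R\<^esub> p \<in> J" if "p \<in> J" "q \<in> carrier ?R" for p q
      using mult[OF that] by (simp add: poly_ring_def)
    show "p \<otimes>\<^bsub>?R\<^esub> q \<in> J" if "p \<in> J" "q \<in> carrier ?R" for p q
      using mult[OF that] by (simp add: poly_ring_def mult.commute)
  qed
  moreover have "binomials U \<subseteq> J"
  proof
    fix p :: "'a mpoly" assume p: "p \<in> binomials U"
    then obtain u v where uv: "(u, v) \<in> U" "p = monomial u + - monomial v"
      by (auto simp: binomials_def)
    then have car: "u \<in> carrier_vec n" "v \<in> carrier_vec n" using U by auto
    have "move n U u v" by (rule move_generator[OF U uv(1)])
    then have "weighted_sum n f p = 0" if "\<forall>a b. move n U a b \<longrightarrow> f a = f b" for f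
      using that uv car
      by (simp add: weighted_sum_add weighted_sum_uminus weighted_sum_monomial del: add_uminus_conv_diff)
    then show "p \<in> J" using p binomials_in_poly_ring[OF U] by (auto simp: J_def)
  qed
  ultimately have "Idl\<^bsub>?R\<^esub> (binomials U) \<subseteq> J" by (rule R.genideal_minimal)
  then show ?thesis using p f by (auto simp: J_def)
qed

text \<open>A path of moves is a telescoping sum of monomial multiples of the generators. For the
  converse, the indicator function of the component of \<open>a\<close> is constant along moves, so
  it takes the same value at \<open>a\<close> and at \<open>b\<close>.\<close>

lemma monomial_diff_in_ideal_iff:
  assumes U: "U \<subseteq> carrier_vec n \<times> carrier_vec n"
    and a: "a \<in> carrier_vec n" and b: "b \<in> carrier_vec n"
  shows "(monomial a - monomial b :: 'k::field mpoly) \<in> Idl\<^bsub>poly_ring n\<^esub> (binomials U) \<longleftrightarrow>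
    equivclp (move n U) a b"
proof
  assume mem: "(monomial a - monomial b :: 'k mpoly) \<in> Idl\<^bsub>poly_ring n\<^esub> (binomials U)"
  let ?f = "\<lambda>c. if equivclp (move n U) a c then 1 else 0 :: 'k"
  have "?f c = ?f d" if "move n U c d" for c d
    using that equivclp_trans[of "move n U"] r_into_equivclp[of "move n U" c d] equivclp_sym
    by (metis)
  then have "weighted_sum n ?f (monomial a + - monomial b :: 'k mpoly) = 0"
    using mem by (intro weighted_sum_ideal[OF U]) auto
  then have "?f a = ?f b"
    unfolding weighted_sum_add weighted_sum_uminus using a b
    by (simp add: weighted_sum_monomial)
  then show "equivclp (move n U) a b" by (simp split: if_splits)
next
  let ?R = "poly_ring n :: 'k mpoly ring"
  let ?I = "Idl\<^bsub>?R\<^esub> (binomials U)"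
  interpret R: cring ?R by (rule poly_ring_cring)
  have I: "ideal ?I ?R" by (rule R.genideal_ideal[OF binomials_in_poly_ring[OF U]])
  have gen: "binomials U \<subseteq> ?I" by (rule R.genideal_self[OF binomials_in_poly_ring[OF U]])
  have add: "p + q \<in> ?I" if "p \<in> ?I" "q \<in> ?I" for p q
    using additive_subgroup.a_closed[OF ideal.axioms(1)[OF I] that] by (simp add: poly_ring_def)
  have mult: "q * p \<in> ?I" if "p \<in> ?I" "q \<in> carrier ?R" for p q
    using ideal.I_l_closed[OF I that] by (simp add: poly_ring_def)
  have zero: "0 \<in> ?I"
    using additive_subgroup.zero_closed[OF ideal.axioms(1)[OF I]] by (simp add: poly_ring_def)
  have one: "- 1 \<in> carrier ?R" by (intro poly_ring_closed(3) poly_ring_consts)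
  have neg: "- p \<in> ?I" if "p \<in> ?I" for p using mult[OF that one] by simp
  have move: "monomial c - monomial d \<in> ?I" if cd: "move n U c d" for c d
  proof -
    obtain t u v where t: "t \<in> carrier_vec n" "(u, v) \<in> U" "c = t + u" "d = t + v"
      using cd by (auto simp: move_def)
    then have car: "u \<in> carrier_vec n" "v \<in> carrier_vec n" using U by auto
    have "(monomial u - monomial v :: 'k mpoly) \<in> ?I" using gen t by (auto simp: binomials_def)
    then have "monomial t * (monomial u - monomial v :: 'k mpoly) \<in> ?I"
      using mult monomial_in_poly_ring[OF t(1)] by blast
    then show ?thesis using t car by (simp add: monomial_add algebra_simps)
  qed
  assume "equivclp (move n U) a b"
  then show "(monomial a - monomial b :: 'k mpoly) \<in> ?I"
  proof (induction rule: equivclp_induct)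
    case base
    show ?case using zero by simp
  next
    case (step y z)
    then have "(monomial y - monomial z :: 'k mpoly) \<in> ?I" using move neg by fastforce
    from add[OF step(3) this] show ?case by simp
  qed
qed

lemma binomial_ideals_eq_iff:
  assumes U: "U \<subseteq> carrier_vec n \<times> carrier_vec n" and V: "V \<subseteq> carrier_vec n \<times> carrier_vec n"
  shows "(Idl\<^bsub>poly_ring n\<^esub> (binomials U) :: 'k::field mpoly set) = Idl\<^bsub>poly_ring n\<^esub> (binomials V) \<longleftrightarrow>
    (\<forall>a\<in>carrier_vec n. \<forall>b\<in>carrier_vec n.
       equivclp (move n U) a b \<longleftrightarrow> equivclp (move n V) a b)" (is "?L = _ \<longleftrightarrow> ?E")
proof
  show "?E" if "?L = Idl\<^bsub>poly_ring n\<^esub> (binomials V)"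
    using that monomial_diff_in_ideal_iff[OF U, where 'k = 'k]
      monomial_diff_in_ideal_iff[OF V, where 'k = 'k] by auto
  have sub: "(Idl\<^bsub>poly_ring n\<^esub> (binomials U) :: 'k mpoly set) \<subseteq> Idl\<^bsub>poly_ring n\<^esub> (binomials V)"
    if U: "U \<subseteq> carrier_vec n \<times> carrier_vec n" and V: "V \<subseteq> carrier_vec n \<times> carrier_vec n"
      and le: "\<And>a b. a \<in> carrier_vec n \<Longrightarrow> b \<in> carrier_vec n \<Longrightarrow>
        equivclp (move n U) a b \<Longrightarrow> equivclp (move n V) a b" for U V
  proof -
    interpret R: cring "poly_ring n :: 'k mpoly ring" by (rule poly_ring_cring)
    have "(binomials U :: 'k mpoly set) \<subseteq> Idl\<^bsub>poly_ring n\<^esub> (binomials V)"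
    proof
      fix p :: "'k mpoly" assume "p \<in> binomials U"
      then obtain u v where uv: "(u, v) \<in> U" "p = monomial u - monomial v"
        by (auto simp: binomials_def)
      then have car: "u \<in> carrier_vec n" "v \<in> carrier_vec n" using U by auto
      then have "equivclp (move n V) u v"
        using le move_generator[OF U uv(1)] by (simp add: r_into_equivclp)
      then show "p \<in> Idl\<^bsub>poly_ring n\<^esub> (binomials V)"
        using monomial_diff_in_ideal_iff[OF V car] uv(2) by simp
    qed
    then show ?thesis
      by (intro R.genideal_minimal R.genideal_ideal binomials_in_poly_ring[OF V])
  qed
  show "?L = Idl\<^bsub>poly_ring n\<^esub> (binomials V)" if "?E"
    by (rule equalityI[OF sub[OF U V] sub[OF V U]]) (use that in auto)
qed

text \<open>Among the finite sets of pairs of full support whose binomials generate the ideal, one of least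
  cardinality gives a minimal generating set: a smaller set of its binomials comes from
  a smaller set of its pairs.\<close>

lemma generic_iff:
  fixes I :: "'k::field mpoly set"
  shows "generic n I \<longleftrightarrow> (\<exists>U. finite U \<and> U \<subseteq> carrier_vec n \<times> carrier_vec n \<and>
      (\<forall>(u, v) \<in> U. \<forall>i<n. u $ i \<noteq> v $ i) \<and> Idl\<^bsub>poly_ring n\<^esub> (binomials U) = I)"
    (is "_ \<longleftrightarrow> (\<exists>U. ?P U)")
proof
  have full: "int a - int b \<noteq> 0 \<longleftrightarrow> a \<noteq> b" for a b by simp
  assume "generic n I"
  then show "\<exists>U. ?P U"
    unfolding generic_def minimal_generating_set_def binomials_def[symmetric] full by blast
next
  assume "\<exists>U. ?P U"
  then obtain U0 where "?P U0" ..
  from ex_has_least_nat[of ?P, OF this, of card]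
  obtain U where "?P U \<and> (\<forall>V. ?P V \<longrightarrow> card U \<le> card V)" by (rule exE)
  then have U: "?P U" and least: "\<forall>V. ?P V \<longrightarrow> card U \<le> card V"
    by (rule conjunct1, rule conjunct2)
  have "Idl\<^bsub>poly_ring n\<^esub> T \<noteq> I" if T: "T \<subset> binomials U" for T
  proof
    assume gen: "Idl\<^bsub>poly_ring n\<^esub> T = I"
    let ?V = "{(u, v) \<in> U. monomial u - monomial v \<in> T}"
    have V: "binomials ?V = T"
    proof (intro equalityI subsetI)
      fix p assume p: "p \<in> T"
      then have "p \<in> binomials U" using T by blast
      then obtain u v where "(u, v) \<in> U" "p = monomial u - monomial v"
        by (auto simp: binomials_def)
      then show "p \<in> binomials ?V" using p by (auto simp: binomials_def)
    qed (auto simp: binomials_def)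
    have "finite ?V" by (rule finite_subset[of _ U]) (use U in auto)
    then have P: "?P ?V" using U V gen by auto
    have "?V \<noteq> U" using V T by fastforce
    then have "card ?V < card U" using U by (intro psubset_card_mono) auto
    then show False using least[rule_format, OF P] by simp
  qed
  then show "generic n I"
    using U binomials_in_poly_ring[where 'k = 'k, of U n]
    unfolding generic_def minimal_generating_set_def binomials_def[symmetric]
    by (intro exI[of _ U]) auto
qed

section \<open>Markov bases of full support\<close>

text \<open>The moves connect two points of the nonnegative orthant exactly if they lie in the same coset of the
  lattice \<open>K\<close>, that is, in the same fibre.\<close>

definition markov_basis :: "nat \<Rightarrow> int vec set \<Rightarrow> (nat vec \<times> nat vec) set \<Rightarrow> bool" where
  "markov_basis n K U \<longleftrightarrow> U \<subseteq> carrier_vec n \<times> carrier_vec n \<and>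
     (\<forall>a\<in>carrier_vec n. \<forall>b\<in>carrier_vec n.
        equivclp (move n U) a b \<longleftrightarrow> map_vec int a - map_vec int b \<in> K)"

definition full_markov_basis :: "nat \<Rightarrow> int vec set \<Rightarrow> (nat vec \<times> nat vec) set \<Rightarrow> bool" where
  "full_markov_basis n K U \<longleftrightarrow>
     finite U \<and> markov_basis n K U \<and> (\<forall>(u, v) \<in> U. \<forall>i<n. u $ i \<noteq> v $ i)"

lemma mat_kernel_difference_iff:
  assumes A: "A \<in> carrier_mat m n" and "x \<in> carrier_vec n" and "y \<in> carrier_vec n"
  shows "x - y \<in> mat_kernel A \<longleftrightarrow> A *\<^sub>v x = A *\<^sub>v y"
proof -
  have "x - y \<in> mat_kernel A \<longleftrightarrow> A *\<^sub>v x - A *\<^sub>v y = 0\<^sub>v m"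
    using assms by (auto simp: mat_kernel_def mult_minus_distrib_mat_vec)
  also have "\<dots> \<longleftrightarrow> A *\<^sub>v x = A *\<^sub>v y"
    using A by (auto simp: vec_eq_iff simp del: index_mult_mat_vec)
  finally show ?thesis .
qed

lemma equivclp_move_difference:
  assumes A: "A \<in> carrier_mat m n" and U: "U \<subseteq> carrier_vec n \<times> carrier_vec n"
    and K: "\<And>u v. (u, v) \<in> U \<Longrightarrow> map_vec int u - map_vec int v \<in> mat_kernel A"
    and a: "a \<in> carrier_vec n" and ab: "equivclp (move n U) a b"
  shows "map_vec int a - map_vec int b \<in> mat_kernel A"
proof -
  have move: "c \<in> carrier_vec n \<and> d \<in> carrier_vec n \<and> map_vec int c - map_vec int d \<in> mat_kernel A"
    if "move n U c d" for c d
  proof -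
    from that obtain t u v
      where t: "t \<in> carrier_vec n" "(u, v) \<in> U" "c = t + u" "d = t + v"
      by (auto simp: move_def)
    then have car: "u \<in> carrier_vec n" "v \<in> carrier_vec n" using U by auto
    then have "map_vec int c - map_vec int d = map_vec int u - map_vec int v"
      using t by (intro eq_vecI) auto
    then show ?thesis using K t car by simp
  qed
  have "b \<in> carrier_vec n \<and> A *\<^sub>v (map_vec int a) = A *\<^sub>v (map_vec int b)"
    using ab
  proof (induction rule: equivclp_induct)
    case base
    show ?case using a by simp
  next
    case (step y z)
    have eq: "A *\<^sub>v (map_vec int c) = A *\<^sub>v (map_vec int d)" if "move n U c d" for c d
    proof -
      show ?thesis using move[OF that]
          mat_kernel_difference_iff[OF A, of "map_vec int c" "map_vec int d"] by auto
    qed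
    have "move n U y z \<or> move n U z y" using step(2) by simp
    then show ?case using step(3) eq move by metis
  qed
  then show ?thesis
    using a mat_kernel_difference_iff[OF A, of "map_vec int a" "map_vec int b"] by auto
qed

text \<open>Subtracting the coordinatewise minimum leaves the positive and the negative part of the difference,
  so congruent vectors differ by a translate of a pair \<open>(w\<^sup>+, w\<^sup>-)\<close>.\<close>

lemma vec_min_decomposition:
  assumes a: "a \<in> carrier_vec n" and b: "b \<in> carrier_vec n"
  obtains g where "g \<in> carrier_vec n"
    and "a = g + pos_part (map_vec int a - map_vec int b)"
    and "b = g + neg_part (map_vec int a - map_vec int b)"
proof
  let ?g = "vec n (\<lambda>i. min (a $ i) (b $ i))"
  show "?g \<in> carrier_vec n" by simp
  show "a = ?g + pos_part (map_vec int a - map_vec int b)"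
    using a b by (intro eq_vecI) (auto simp: pos_part_def)
  show "b = ?g + neg_part (map_vec int a - map_vec int b)"
    using a b by (intro eq_vecI) (auto simp: neg_part_def)
qed

lemma pos_neg_carrier [simp]:
  "pos_part w \<in> carrier_vec n \<longleftrightarrow> w \<in> carrier_vec n"
  "neg_part w \<in> carrier_vec n \<longleftrightarrow> w \<in> carrier_vec n"
  by (simp_all add: pos_part_def neg_part_def)

lemma pos_minus_neg: "map_vec int (pos_part w) - map_vec int (neg_part w) = w"
  by (intro eq_vecI) (auto simp: pos_part_def neg_part_def)

definition kernel_pairs :: "int mat \<Rightarrow> (nat vec \<times> nat vec) set" where
  "kernel_pairs A = (\<lambda>u. (pos_part u, neg_part u)) ` mat_kernel A"

lemma toric_ideal_eq:
  assumes "A \<in> carrier_mat m n"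
  shows "(toric_ideal A :: 'k::field mpoly set) = Idl\<^bsub>poly_ring n\<^esub> (binomials (kernel_pairs A))"
proof -
  have "{monomial (pos_part u) - monomial (neg_part u) :: 'k mpoly | u. u \<in> mat_kernel A} =
      binomials (kernel_pairs A)"
    by (auto simp: binomials_def kernel_pairs_def)
  then show ?thesis using assms by (simp add: toric_ideal_def)
qed

lemma markov_basis_kernel_pairs:
  assumes A: "A \<in> carrier_mat m n"
  shows "markov_basis n (mat_kernel A) (kernel_pairs A)"
proof -
  have U: "kernel_pairs A \<subseteq> carrier_vec n \<times> carrier_vec n"
    using A by (auto simp: kernel_pairs_def mat_kernel_def)
  have "equivclp (move n (kernel_pairs A)) a b"
    if "a \<in> carrier_vec n" "b \<in> carrier_vec n" "map_vec int a - map_vec int b \<in> mat_kernel A" for a b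
  proof -
    from that(1,2) obtain g
      where "g \<in> carrier_vec n" "a = g + pos_part (map_vec int a - map_vec int b)"
        "b = g + neg_part (map_vec int a - map_vec int b)"
      by (rule vec_min_decomposition)
    then have "move n (kernel_pairs A) a b"
      using that(3) unfolding move_def kernel_pairs_def by blast
    then show ?thesis by (rule r_into_equivclp)
  qed
  moreover have "map_vec int a - map_vec int b \<in> mat_kernel A"
    if "a \<in> carrier_vec n" "equivclp (move n (kernel_pairs A)) a b" for a b
    by (rule equivclp_move_difference[OF A U _ that]) (auto simp: kernel_pairs_def pos_minus_neg)
  ultimately show ?thesis using U by (auto simp: markov_basis_def)
qed

text \<open>Binomial ideals are equal exactly if their moves have the same components, and the defining
  generators of the toric ideal connect each pair that differs by a kernel vector, even in one
  move.\<close>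

lemma generic_toric_iff_markov:
  assumes A: "A \<in> carrier_mat m n"
  shows "generic n (toric_ideal A :: 'k::field mpoly set) \<longleftrightarrow>
    (\<exists>U. full_markov_basis n (mat_kernel A) U)"
proof -
  have "(Idl\<^bsub>poly_ring n\<^esub> (binomials U) :: 'k mpoly set) = toric_ideal A \<longleftrightarrow>
      markov_basis n (mat_kernel A) U" if "U \<subseteq> carrier_vec n \<times> carrier_vec n" for U
    using that markov_basis_kernel_pairs[OF A]
      binomial_ideals_eq_iff[where 'k = 'k, OF that, of "kernel_pairs A"]
    by (simp add: toric_ideal_eq[OF A] markov_basis_def)
  then have "full_markov_basis n (mat_kernel A) U \<longleftrightarrow>
      finite U \<and> U \<subseteq> carrier_vec n \<times> carrier_vec n \<and>
      (\<forall>(u, v) \<in> U. \<forall>i<n. u $ i \<noteq> v $ i) \<and>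
      (Idl\<^bsub>poly_ring n\<^esub> (binomials U) :: 'k mpoly set) = toric_ideal A" for U
    by (cases "U \<subseteq> carrier_vec n \<times> carrier_vec n")
      (auto simp: full_markov_basis_def markov_basis_def)
  then show ?thesis unfolding generic_iff by simp
qed

section \<open>Transport of Markov bases along an inflation\<close>

locale inflation =
  fixes n s :: nat and \<beta> d :: "nat \<Rightarrow> nat"
  assumes surj: "\<beta> ` {..<n} = {..<s}" and pos: "\<And>i. i < n \<Longrightarrow> d i > 0"
begin

abbreviation C :: "nat vec \<Rightarrow> nat vec" where "C \<equiv> inflate n \<beta> d"
abbreviation D :: "int vec \<Rightarrow> int vec" where "D \<equiv> inflate n \<beta> (\<lambda>i. int (d i))"

lemma block: "i < n \<Longrightarrow> \<beta> i < s"
  using surj by auto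

lemma inflate_carrier [simp]: "inflate n \<beta> e w \<in> carrier_vec n"
  by (simp add: inflate_def)

lemma dim_inflate [simp]: "dim_vec (inflate n \<beta> e w) = n"
  by (simp add: inflate_def)

lemma inflate_add:
  assumes "a \<in> carrier_vec s" and "b \<in> carrier_vec s"
  shows "C (a + b) = C a + C b"
  using assms block by (intro eq_vecI) (auto simp: inflate_def algebra_simps)

lemma inflate_difference:
  assumes "a \<in> carrier_vec s" and "b \<in> carrier_vec s"
  shows "map_vec int (C a) - map_vec int (C b) = D (map_vec int a - map_vec int b)"
  using assms block by (intro eq_vecI) (auto simp: inflate_def algebra_simps)

lemma inflate_parts:
  assumes "w \<in> carrier_vec s"
  shows "pos_part (D w) = C (pos_part w)" and "neg_part (D w) = C (neg_part w)"
proof -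
  have "nat (- (int (d i) * x)) = d i * nat (- x)" for i x
    using nat_mult_distrib[of "int (d i)" "- x"] by simp
  then show "pos_part (D w) = C (pos_part w)" "neg_part (D w) = C (neg_part w)"
    using assms block
    by (auto simp: inflate_def pos_part_def neg_part_def nat_mult_distrib intro!: eq_vecI)
qed

lemma inflate_inj:
  assumes "a \<in> carrier_vec s" and "b \<in> carrier_vec s" and "C a = C b"
  shows "a = b"
proof (rule eq_vecI)
  fix k assume "k < dim_vec b"
  then obtain i where i: "i < n" "k = \<beta> i" using assms(2) surj by auto
  have "C a $ i = C b $ i" using assms(3) by simp
  then show "a $ k = b $ k" using i pos[OF i(1)] by (simp add: inflate_def)
qed (use assms in simp)

text \<open>A move that starts in the image of \<open>C\<close> and changes the vector by an element of the image of \<open>D\<close>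
  is the image of a translate of the move \<open>w\<^sup>+ \<rightarrow> w\<^sup>-\<close>: nonnegativity of \<open>t\<close> and \<open>v\<close> forces
  \<open>d\<^sub>i w\<^sub>k \<le> d\<^sub>i c\<^sub>k\<close> in each block \<open>k\<close>, hence \<open>w\<^sup>+ \<le> c\<close> because the weights are positive.\<close>

lemma move_deflate:
  assumes c: "c \<in> carrier_vec s" and w: "w \<in> carrier_vec s"
    and car: "t \<in> carrier_vec n" "u \<in> carrier_vec n" "v \<in> carrier_vec n"
    and uv: "map_vec int u - map_vec int v = D w" and Cc: "C c = t + u"
  obtains r where "r \<in> carrier_vec s" and "c = r + pos_part w" and "t + v = C (r + neg_part w)"
proof
  let ?r = "vec s (\<lambda>k. c $ k - nat (w $ k))"
  have entry: "int (d i) * w $ \<beta> i = int (u $ i) - int (v $ i)" "d i * c $ \<beta> i = t $ i + u $ i"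
    if "i < n" for i
    using arg_cong[OF uv, of "\<lambda>x. x $ i"] arg_cong[OF Cc, of "\<lambda>x. x $ i"] that car
    by (simp_all add: inflate_def)
  have le: "w $ k \<le> int (c $ k)" if "k < s" for k
  proof -
    from that obtain i where i: "i < n" "k = \<beta> i" using surj by auto
    have "int (d i) * w $ k \<le> int (d i) * int (c $ k)"
      using entry[OF i(1)] i(2) by (simp flip: of_nat_mult)
    then show ?thesis using pos[OF i(1)] by simp
  qed
  show "?r \<in> carrier_vec s" by simp
  show "c = ?r + pos_part w"
    using c w le by (intro eq_vecI) (auto simp: pos_part_def nat_le_iff)
  have "int ((t + v) $ i) = int (C (?r + neg_part w) $ i)" if "i < n" for i
  proof -
    have b: "\<beta> i < s" using block[OF that] .
    have "int ((?r + neg_part w) $ \<beta> i) = int (c $ \<beta> i) - w $ \<beta> i"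
      using le[OF b] b w by (auto simp: neg_part_def)
    moreover have "int (C (?r + neg_part w) $ i) = int (d i) * int ((?r + neg_part w) $ \<beta> i)"
      using that by (simp add: inflate_def)
    ultimately have "int (C (?r + neg_part w) $ i) = int (d i * c $ \<beta> i) - int (d i) * w $ \<beta> i"
      by (simp only: right_diff_distrib of_nat_mult)
    then show ?thesis using entry[OF that] that car by simp
  qed
  then have "(t + v) $ i = C (?r + neg_part w) $ i" if "i < n" for i
    using that of_nat_eq_iff by blast
  then show "t + v = C (?r + neg_part w)"
    using car by (intro eq_vecI) (simp_all del: index_add_vec add: index_add_vec(2))
qed

text \<open>A path from \<open>w\<^sup>+\<close> to \<open>w\<^sup>-\<close> is mapped by \<open>C\<close> to a path between the positive and negative parts of
  \<open>D w\<close>, and its translates connect all pairs with difference \<open>D w\<close>.\<close>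

lemma full_markov_basis_inflate:
  assumes K: "mat_kernel A = D ` mat_kernel A'"
    and A: "A \<in> carrier_mat m n" and A': "A' \<in> carrier_mat m' s"
    and V: "full_markov_basis s (mat_kernel A') V"
  shows "full_markov_basis n (mat_kernel A) (map_prod C C ` V)" (is "full_markov_basis _ _ ?U")
proof -
  have V_car: "V \<subseteq> carrier_vec s \<times> carrier_vec s"
    and V_conn: "\<And>a b. a \<in> carrier_vec s \<Longrightarrow> b \<in> carrier_vec s \<Longrightarrow>
      equivclp (move s V) a b \<longleftrightarrow> map_vec int a - map_vec int b \<in> mat_kernel A'"
    and V_full: "\<And>u v k. (u, v) \<in> V \<Longrightarrow> k < s \<Longrightarrow> u $ k \<noteq> v $ k"
    and fin: "finite V"
    using V by (auto simp: full_markov_basis_def markov_basis_def)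
  have U: "?U \<subseteq> carrier_vec n \<times> carrier_vec n" by auto
  have full: "\<forall>(u, v) \<in> ?U. \<forall>i<n. u $ i \<noteq> v $ i"
    using V_full block pos by (fastforce simp: inflate_def)
  have diff: "map_vec int u - map_vec int v \<in> mat_kernel A" if "(u, v) \<in> ?U" for u v
  proof -
    from that obtain p q where pq: "(p, q) \<in> V" "u = C p" "v = C q" by auto
    then have car: "p \<in> carrier_vec s" "q \<in> carrier_vec s" using V_car by auto
    have "move s V p q" by (rule move_generator[OF V_car pq(1)])
    then have "map_vec int p - map_vec int q \<in> mat_kernel A'"
      using V_conn[OF car] by (simp add: r_into_equivclp)
    then show ?thesis using pq car K by (simp add: inflate_difference)
  qed
  have move_C: "move n ?U (C x) (C y)" if "move s V x y" for x y
  proof -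
    from that obtain t u v
      where t: "t \<in> carrier_vec s" "(u, v) \<in> V" "x = t + u" "y = t + v"
      by (auto simp: move_def)
    then have "u \<in> carrier_vec s" "v \<in> carrier_vec s" using V_car by auto
    then have "C x = C t + C u" "C y = C t + C v" using t by (simp_all add: inflate_add)
    moreover have "(C u, C v) \<in> ?U" using t(2) by force
    ultimately show ?thesis unfolding move_def
      by (intro exI[of _ "C t"] exI[of _ "C u"] exI[of _ "C v"]) simp
  qed
  have "equivclp (move n ?U) a b"
    if car: "a \<in> carrier_vec n" "b \<in> carrier_vec n"
      and ker: "map_vec int a - map_vec int b \<in> mat_kernel A" for a b
  proof -
    obtain w where w: "map_vec int a - map_vec int b = D w" "w \<in> mat_kernel A'"
      using ker unfolding K by (rule imageE)
    then have w_car: "w \<in> carrier_vec s" using A' by (simp add: mat_kernel_def)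
    have "equivclp (move s V) (pos_part w) (neg_part w)"
      using V_conn w w_car by (simp add: pos_minus_neg)
    then have CC: "equivclp (move n ?U) (C (pos_part w)) (C (neg_part w))"
      by (rule equivclp_map[where f = C]) (rule move_C)
    from car obtain g
      where g: "g \<in> carrier_vec n" "a = g + pos_part (map_vec int a - map_vec int b)"
        "b = g + neg_part (map_vec int a - map_vec int b)"
      by (rule vec_min_decomposition)
    have "equivclp (move n ?U) (g + C (pos_part w)) (g + C (neg_part w))"
      using CC by (rule equivclp_map[where f = "\<lambda>x. g + x"])
        (rule move_translate[OF U g(1)])
    moreover note g(2,3)[unfolded w(1) inflate_parts[OF w_car], symmetric]
    ultimately show ?thesis by simp
  qed
  moreover have "map_vec int a - map_vec int b \<in> mat_kernel A"
    if "a \<in> carrier_vec n" "equivclp (move n ?U) a b" for a b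
    using equivclp_move_difference[OF A U diff that] .
  ultimately show ?thesis
    using U full fin by (simp add: full_markov_basis_def markov_basis_def iff_conv_conj_imp)
qed

text \<open>Let \<open>(u, v)\<close> be a basis move and \<open>u - v = D w\<close>; the new basis consists of the pairs
  \<open>(w\<^sup>+, w\<^sup>-)\<close>. They have full support because every coordinate of \<open>w\<close> occurs, up to a positive
  factor, in \<open>D w\<close>. To connect \<open>a\<close> and \<open>b\<close>, start from a path between \<open>C a\<close> and \<open>C b\<close>; by
  \<open>move_deflate\<close> all its points lie in the image of \<open>C\<close>, and its steps are images of new moves.\<close>

lemma full_markov_basis_deflate:
  assumes K: "mat_kernel A = D ` mat_kernel A'"
    and A: "A \<in> carrier_mat m n" and A': "A' \<in> carrier_mat m' s"
    and U: "full_markov_basis n (mat_kernel A) U"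
  obtains V where "full_markov_basis s (mat_kernel A') V"
proof -
  have U_car: "U \<subseteq> carrier_vec n \<times> carrier_vec n"
    and U_conn: "\<And>a b. a \<in> carrier_vec n \<Longrightarrow> b \<in> carrier_vec n \<Longrightarrow>
      equivclp (move n U) a b \<longleftrightarrow> map_vec int a - map_vec int b \<in> mat_kernel A"
    and U_full: "\<And>u v i. (u, v) \<in> U \<Longrightarrow> i < n \<Longrightarrow> u $ i \<noteq> v $ i"
    and fin: "finite U"
    using U by (auto simp: full_markov_basis_def markov_basis_def)
  have "\<exists>w\<in>mat_kernel A'. map_vec int (fst p) - map_vec int (snd p) = D w" if "p \<in> U" for p
  proof -
    obtain u v where p: "p = (u, v)" by (cases p)
    then have car: "u \<in> carrier_vec n" "v \<in> carrier_vec n" using that U_car by auto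
    have "move n U u v" using p that move_generator[OF U_car] by simp
    then have "map_vec int u - map_vec int v \<in> mat_kernel A"
      using U_conn[OF car] by (simp add: r_into_equivclp)
    then show ?thesis using K p by auto
  qed
  then obtain w where w: "\<And>p. p \<in> U \<Longrightarrow> w p \<in> mat_kernel A'"
    "\<And>p. p \<in> U \<Longrightarrow> map_vec int (fst p) - map_vec int (snd p) = D (w p)" by metis
  have w_car: "w p \<in> carrier_vec s" if "p \<in> U" for p
    using w(1)[OF that] A' by (simp add: mat_kernel_def)
  define V where "V = (\<lambda>p. (pos_part (w p), neg_part (w p))) ` U"
  have V_car: "V \<subseteq> carrier_vec s \<times> carrier_vec s" using w_car by (auto simp: V_def)
  have "pos_part (w p) $ k \<noteq> neg_part (w p) $ k" if p: "p \<in> U" and k: "k < s" for p k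
  proof -
    obtain u v where uv: "p = (u, v)" by (cases p)
    then have car: "u \<in> carrier_vec n" "v \<in> carrier_vec n" using p U_car by auto
    obtain i where i: "i < n" "k = \<beta> i" using k surj by auto
    have "int (u $ i) - int (v $ i) = int (d i) * w p $ k"
      using arg_cong[OF w(2)[OF p], of "\<lambda>x. x $ i"] uv car i by (simp add: inflate_def)
    then have "w p $ k \<noteq> 0" using U_full[of u v i] p uv i by auto
    then show ?thesis using w_car[OF p] k by (auto simp: pos_part_def neg_part_def)
  qed
  then have V_full: "\<forall>(u, v) \<in> V. \<forall>k<s. u $ k \<noteq> v $ k" by (auto simp: V_def)
  have diff: "map_vec int u - map_vec int v \<in> mat_kernel A'" if "(u, v) \<in> V" for u v
    using that w(1) by (auto simp: V_def pos_minus_neg)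
  have forward: "\<exists>e\<in>carrier_vec s. z = C e \<and> move s V c e"
    if c: "c \<in> carrier_vec s" and mv: "move n U (C c) z" for c z
  proof -
    obtain t u v where t: "t \<in> carrier_vec n" "(u, v) \<in> U" "C c = t + u" "z = t + v"
      using mv by (auto simp: move_def)
    then have car: "u \<in> carrier_vec n" "v \<in> carrier_vec n" using U_car by auto
    have wuv: "w (u, v) \<in> carrier_vec s" "map_vec int u - map_vec int v = D (w (u, v))"
      using w_car[OF t(2)] w(2)[OF t(2)] by simp_all
    obtain r where r: "r \<in> carrier_vec s" "c = r + pos_part (w (u, v))"
      "t + v = C (r + neg_part (w (u, v)))"
      using move_deflate[OF c wuv(1) t(1) car wuv(2) t(3)] .
    have "(pos_part (w (u, v)), neg_part (w (u, v))) \<in> V" using t(2) by (auto simp: V_def)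
    then have "move s V c (r + neg_part (w (u, v)))" using r unfolding move_def by blast
    then show ?thesis using r t wuv by (intro bexI[of _ "r + neg_part (w (u, v))"]) auto
  qed
  have backward: "\<exists>e\<in>carrier_vec s. z = C e \<and> move s V e c"
    if c: "c \<in> carrier_vec s" and mv: "move n U z (C c)" for c z
  proof -
    obtain t u v where t: "t \<in> carrier_vec n" "(u, v) \<in> U" "C c = t + v" "z = t + u"
      using mv by (auto simp: move_def)
    then have car: "u \<in> carrier_vec n" "v \<in> carrier_vec n" using U_car by auto
    \<comment> \<open>The reversed move changes the vector by \<open>D (- w)\<close>, and negation swaps the two parts.\<close>
    let ?w = "- w (u, v)"
    have wuv: "w (u, v) \<in> carrier_vec s" "map_vec int u - map_vec int v = D (w (u, v))"
      using w_car[OF t(2)] w(2)[OF t(2)] by simp_all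
    have w': "?w \<in> carrier_vec s" using wuv by simp
    have "map_vec int v - map_vec int u = - (map_vec int u - map_vec int v)"
      using car by (intro eq_vecI) auto
    also have "\<dots> = D ?w"
      unfolding wuv(2) using wuv(1) block by (intro eq_vecI) (auto simp: inflate_def)
    finally have vu: "map_vec int v - map_vec int u = D ?w" .
    obtain r where r: "r \<in> carrier_vec s" "c = r + pos_part ?w" "t + u = C (r + neg_part ?w)"
      using move_deflate[OF c w' t(1) car(2,1) vu t(3)] .
    have flip: "pos_part ?w = neg_part (w (u, v))" "neg_part ?w = pos_part (w (u, v))"
      by (auto simp: pos_part_def neg_part_def)
    have "(pos_part (w (u, v)), neg_part (w (u, v))) \<in> V" using t(2) by (auto simp: V_def)
    then have "move s V (r + pos_part (w (u, v))) c" using r unfolding move_def flip by blast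
    then show ?thesis using r t wuv unfolding flip
      by (intro bexI[of _ "r + pos_part (w (u, v))"]) auto
  qed
  have "equivclp (move s V) a b"
    if car: "a \<in> carrier_vec s" "b \<in> carrier_vec s"
      and ker: "map_vec int a - map_vec int b \<in> mat_kernel A'" for a b
  proof -
    have "equivclp (move n U) (C a) (C b)"
      using U_conn[of "C a" "C b"] car ker K by (simp add: inflate_difference)
    then have "\<exists>e\<in>carrier_vec s. C b = C e \<and> equivclp (move s V) a e"
    proof (induction rule: equivclp_induct)
      case base
      show ?case using car by auto
    next
      case (step y z)
      then obtain c where c: "c \<in> carrier_vec s" "y = C c" "equivclp (move s V) a c" by blast
      then obtain e where "e \<in> carrier_vec s" "z = C e" "move s V c e \<or> move s V e c"
        using step(2) forward[OF c(1)] backward[OF c(1)] by blast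
      then show ?case using c(3) equivclp_into_equivclp by metis
    qed
    then show ?thesis using inflate_inj[OF car(2)] by auto
  qed
  moreover have "map_vec int a - map_vec int b \<in> mat_kernel A'"
    if "a \<in> carrier_vec s" "equivclp (move s V) a b" for a b
    using equivclp_move_difference[OF A' V_car diff that] .
  moreover have "finite V" using fin by (simp add: V_def)
  ultimately have "full_markov_basis s (mat_kernel A') V"
    using V_car V_full by (simp add: full_markov_basis_def markov_basis_def iff_conv_conj_imp)
  then show thesis by (rule that)
qed

end

theorem theorem3p9:
  fixes A G :: "int mat" and m n :: nat and Bs :: "nat set list"
  assumes "A \<in> carrier_mat m n"
    and "gale_matrix A G"
    and "no_free_bouquet A"
    and "distinct Bs" and "set Bs = bouquets A"
    and "stable_toric A"
  shows "generic n (toric_ideal A :: 'k::field mpoly set) \<longleftrightarrow>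
         generic (length Bs) (toric_ideal (bouquet_matrix A G Bs) :: 'k mpoly set)"
proof -
  let ?AB = "bouquet_matrix A G Bs"
  obtain \<beta> d where surj: "\<beta> ` {..<n} = {..<length Bs}" and pos: "\<And>i. i < n \<Longrightarrow> d i > 0"
    and K: "mat_kernel A = inflate n \<beta> (\<lambda>i. int (d i)) ` mat_kernel ?AB"
    by (rule kernel_inflation[OF assms]) (rule that)
  interpret inflation n "length Bs" \<beta> d by (rule inflation.intro[OF surj pos])
  have AB: "?AB \<in> carrier_mat m (length Bs)"
    using assms(1) mat_of_cols_carrier(1)[of m "map (bouquet_a A G) Bs"]
    by (simp add: bouquet_matrix_def)
  show ?thesis
    unfolding generic_toric_iff_markov[OF assms(1)] generic_toric_iff_markov[OF AB]
  proof
    assume "\<exists>U. full_markov_basis n (mat_kernel A) U"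
    then obtain U where "full_markov_basis n (mat_kernel A) U" ..
    then obtain V where "full_markov_basis (length Bs) (mat_kernel ?AB) V"
      by (rule full_markov_basis_deflate[OF K assms(1) AB])
    then show "\<exists>V. full_markov_basis (length Bs) (mat_kernel ?AB) V" ..
  next
    assume "\<exists>V. full_markov_basis (length Bs) (mat_kernel ?AB) V"
    then obtain V where "full_markov_basis (length Bs) (mat_kernel ?AB) V" ..
    then have "full_markov_basis n (mat_kernel A) (map_prod C C ` V)"
      by (rule full_markov_basis_inflate[OF K assms(1) AB])
    then show "\<exists>U. full_markov_basis n (mat_kernel A) U" ..
  qed
qed

end
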